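(* There exists a universal constant $c>0$ such that for all integers $v\ge 1$, $1\le t\le v$ and $t\le k\le v$ there exists, for some $\lambda$, a non-empty (simple) $t$-$(v,k,\lambda)$ design whose size (number of sets) is at most $v^{ct}$.
   Context: For a positive integer $v$, $[v]=\{1,\ldots,v\}$. A (simple) $t$-$(v,k,\lambda)$ design is a family $T$ of distinct subsets of $[v]$, each of size $k$, such that any $t$ distinct elements of $[v]$ belong together to exactly $\lambda$ sets of the family; that is, for any distinct $i_1,\ldots,i_t\in[v]$, $$|\{s\in T: i_1,\ldots,i_t\in s\}|=\frac{\binom{k}{t}}{\binom{v}{t}}|T|=\lambda.$$ The size of the design is $|T|$. *)

theory Defs
  imports Complex_Main
begin

definition is_design :: "nat \<Rightarrow> nat \<Rightarrow> nat \<Rightarrow> nat \<Rightarrow> nat set set \<Rightarrow> bool" where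
  "is_design t v k l T \<longleftrightarrow>
     (\<forall>s\<in>T. s \<subseteq> {1..v} \<and> card s = k) \<and>
     (\<forall>I. I \<subseteq> {1..v} \<and> card I = t \<longrightarrow> card {s \<in> T. I \<subseteq> s} = l)"

text \<open>
  For \<open>t \<le> v\<close>, double counting the pairs \<open>(I, s)\<close> with \<open>I \<subseteq> s\<close> shows that
  \<open>l\<close> is determined by the size of the design.
\<close>

lemma is_design_lambda_eq:
  assumes D: "is_design t v k l T" and tv: "t \<le> v"
  shows "real l = real (k choose t) / real (v choose t) * real (card T)"
proof -
  define P where "P = {I. I \<subseteq> {1..v} \<and> card I = t}"
  have T: "s \<subseteq> {1..v}" "card s = k" if "s \<in> T" for s
    using D that by (auto simp: is_design_def)
  have "T \<subseteq> Pow {1..v}" using T by blast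
  then have finT: "finite T" by (rule finite_subset) simp
  have finP: "finite P" by (simp add: P_def)
  have cardP: "card P = v choose t"
    unfolding P_def by (simp add: n_subsets)
  have "(\<Sum>I\<in>P. card {s \<in> T. I \<subseteq> s}) = (\<Sum>I\<in>P. l)"
    using D by (intro sum.cong) (auto simp: is_design_def P_def)
  moreover have "(\<Sum>I\<in>P. card {s \<in> T. I \<subseteq> s}) = (\<Sum>s\<in>T. card {I \<in> P. I \<subseteq> s})"
    by (rule sum_multicount_gen[OF finP finT]) (auto)
  moreover have "(\<Sum>s\<in>T. card {I \<in> P. I \<subseteq> s}) = (\<Sum>s\<in>T. k choose t)"
  proof (rule sum.cong[OF refl])
    fix s assume s: "s \<in> T"
    have "{I \<in> P. I \<subseteq> s} = {I. I \<subseteq> s \<and> card I = t}"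
      using T(1)[OF s] by (auto simp: P_def)
    moreover have "finite s" using T(1)[OF s] by (rule finite_subset) simp
    ultimately show "card {I \<in> P. I \<subseteq> s} = k choose t"
      using T(2)[OF s] by (simp add: n_subsets)
  qed
  ultimately have "(v choose t) * l = card T * (k choose t)"
    by (simp add: cardP)
  then have "real (v choose t) * real l = real (card T) * real (k choose t)"
    by (metis of_nat_mult)
  moreover have "v choose t \<noteq> 0" using tv by (simp add: zero_less_binomial)
  ultimately show ?thesis by (simp add: field_simps)
qed

end

theory Submission
  imports Defs
begin

text \<open>
  If \<open>v choose k\<close> is at most \<open>v ^ (50 * t)\<close>, the family of all \<open>k\<close>-subsets is small enough.
  Otherwise there are so many \<open>k\<close>-subsets that a family of \<open>v ^ O(t)\<close> of them, chosen almost at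
  random, can be repaired into an exact design by local switches.  The difficulty is integrality:
  the errors of a random family must be integer combinations of available switches, with few
  switches in total.  Passing from sets to matchings removes it.

  \<^bold>\<open>Coordinates.\<close>  Split the points into \<open>B\<close> with \<open>k\<close> elements and its complement \<open>A\<close>.
  Every \<open>k\<close>-set arises from \<open>B\<close> by exchanging points along a partial matching \<open>\<mu>\<close> between
  \<open>A\<close> and \<open>B\<close>, and the \<open>k\<close>-sets with \<open>x\<close> points in \<open>A\<close> arise from \<open>x!\<close> matchings each.  Give \<open>\<mu>\<close> the
  weight \<open>1 / ((v choose k) * |\<mu>|!)\<close>.  Then the induced distribution on \<open>k\<close>-sets is uniform, and the
  matchings that contain a given \<open>\<rho>\<close> have total weight \<open>(v - |\<rho>|)! / v!\<close>, which depends on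
  \<open>|\<rho>|\<close> only.  Whether \<open>I\<close> lies in the block of \<open>\<mu>\<close> is a linear combination of the
  indicators of \<open>\<rho> \<subseteq> \<mu>\<close> with \<open>|\<rho>| \<le> |I|\<close>.  So a set of \<open>N\<close> matchings with distinct blocks yields a
  \<open>t\<close>-design as soon as every \<open>\<rho>\<close> with at most \<open>t\<close> pairs is contained in exactly
  \<open>N * (v - |\<rho>|)! / v!\<close> of them (\<open>uniform_matchings_give_design\<close>), and these targets are integers
  when \<open>N\<close> is a multiple of \<open>v! / (v - t)!\<close>.

  \<^bold>\<open>Switches.\<close>  For \<open>\<sigma> \<subseteq> \<mu>\<close>, the \<open>2 ^ |\<sigma>|\<close> matchings that agree with \<open>\<mu>\<close> outside \<open>\<sigma>\<close> and are contained in
  \<open>\<mu>\<close> fall into two halves according to the parity of the number of omitted pairs.  Replacing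
  one half by the other changes the number of members above \<open>\<rho>\<close> by one if
  \<open>\<sigma> \<subseteq> \<rho> \<subseteq> \<mu>\<close>, and not at all otherwise (\<open>half_switch\<close>).  Hence the errors can be removed in the order of
  increasing \<open>|\<rho>|\<close>: switches for \<open>\<sigma>\<close> adjust the count at \<open>\<sigma>\<close> and disturb only
  larger matchings.  If the size is right and the initial errors are at most \<open>\<Delta>\<close>, then
  \<open>\<Delta> * (t + 1) ^ t\<close> switches per \<open>\<sigma>\<close> suffice (\<open>level_correction\<close>), and \<open>(t + 1) ^ t \<le> v ^ t\<close>.

  \<^bold>\<open>The initial family.\<close>  For each \<open>\<sigma>\<close> and each sign take \<open>M\<close> gadgets, each with one half
  present, where \<open>\<mu>\<close> is random among the matchings containing \<open>\<sigma>\<close>.  Add independent random matchings, distributed so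
  that the expected counts of the whole family are exactly the targets.  Its size \<open>N\<close> is only
  \<open>v ^ O(t)\<close> times \<open>M\<close>, while its errors are at most \<open>v ^ O(t) * sqrt N\<close>; so for \<open>M\<close> a
  large power of \<open>v ^ t\<close> the gadgets suffice to repair it.  All blocks are distinct with
  high probability since \<open>v choose k\<close> is much larger than \<open>N ^ 2\<close>.  Instead of a probability
  space, \<open>greedy_selection\<close> makes the random choices one after the other, each nearly as good as the average.
\<close>

section \<open>Partial matchings\<close>
definition matchings :: "'a set \<Rightarrow> 'b set \<Rightarrow> ('a \<times> 'b) set set" where
  "matchings A B = {\<mu>. \<mu> \<subseteq> A \<times> B \<and> inj_on fst \<mu> \<and> inj_on snd \<mu>}"

definition swap :: "'a set \<Rightarrow> ('a \<times> 'a) set \<Rightarrow> 'a set" where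
  "swap B \<mu> = (B - snd ` \<mu>) \<union> fst ` \<mu>"

lemma finite_matchings: "finite A \<Longrightarrow> finite B \<Longrightarrow> finite (matchings A B)"
  by (rule finite_subset[of _ "Pow (A \<times> B)"]) (auto simp: matchings_def)

lemma finite_matching: "finite A \<Longrightarrow> finite B \<Longrightarrow> \<mu> \<in> matchings A B \<Longrightarrow> finite \<mu>"
  by (auto simp: matchings_def intro: finite_subset)

lemma matching_subset: "\<mu> \<in> matchings A B \<Longrightarrow> \<rho> \<subseteq> \<mu> \<Longrightarrow> \<rho> \<in> matchings A B"
  by (auto simp: matchings_def intro: inj_on_subset)

lemma empty_matching [simp]: "{} \<in> matchings A B"
  by (simp add: matchings_def)

lemma card_fst_matching: "\<mu> \<in> matchings A B \<Longrightarrow> card (fst ` \<mu>) = card \<mu>"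
  by (auto simp: matchings_def intro: card_image)

lemma card_snd_matching: "\<mu> \<in> matchings A B \<Longrightarrow> card (snd ` \<mu>) = card \<mu>"
  by (auto simp: matchings_def intro: card_image)

lemma card_matching_le: "finite A \<Longrightarrow> \<mu> \<in> matchings A B \<Longrightarrow> card \<mu> \<le> card A"
  by (subst card_fst_matching[symmetric]) (auto simp: matchings_def intro!: card_mono)

lemma matchings_empty_left: "matchings {} B = {{}}"
  by (auto simp: matchings_def)

lemma matching_unique_fst: "\<mu> \<in> matchings A B \<Longrightarrow> (a, b) \<in> \<mu> \<Longrightarrow> (a, b') \<in> \<mu> \<Longrightarrow> b = b'"
  unfolding matchings_def inj_on_def by (metis (mono_tags, lifting) fst_conv mem_Collect_eq prod.inject)

lemma matching_unique_snd: "\<mu> \<in> matchings A B \<Longrightarrow> (a, b) \<in> \<mu> \<Longrightarrow> (a', b) \<in> \<mu> \<Longrightarrow> a = a'"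
  unfolding matchings_def inj_on_def by (metis (mono_tags, lifting) snd_conv mem_Collect_eq prod.inject)

lemma matchingsI:
  assumes "\<mu> \<subseteq> A \<times> B"
    and "\<And>a b b'. (a, b) \<in> \<mu> \<Longrightarrow> (a, b') \<in> \<mu> \<Longrightarrow> b = b'"
    and "\<And>a a' b. (a, b) \<in> \<mu> \<Longrightarrow> (a', b) \<in> \<mu> \<Longrightarrow> a = a'"
  shows "\<mu> \<in> matchings A B"
  using assms by (auto simp: matchings_def inj_on_def)

text \<open>
  The pairs of a matching other than those of \<open>\<rho>\<close> form an arbitrary matching of the points
  that \<open>\<rho>\<close> leaves free.
\<close>
lemma bij_betw_matchings_superset:
  assumes \<rho>: "\<rho> \<in> matchings A B"
  shows "bij_betw (\<lambda>\<mu>. \<rho> \<union> \<mu>) (matchings (A - fst ` \<rho>) (B - snd ` \<rho>)) {\<mu> \<in> matchings A B. \<rho> \<subseteq> \<mu>}"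
proof (rule bij_betw_byWitness[where f' = "\<lambda>\<mu>. \<mu> - \<rho>"])
  have dis: "\<mu> \<inter> \<rho> = {}" if "\<mu> \<in> matchings (A - fst ` \<rho>) (B - snd ` \<rho>)" for \<mu>
    using that by (force simp: matchings_def)
  show "\<forall>\<mu>\<in>matchings (A - fst ` \<rho>) (B - snd ` \<rho>). \<rho> \<union> \<mu> - \<rho> = \<mu>"
    using dis by blast
  show "\<forall>\<mu>\<in>{\<mu> \<in> matchings A B. \<rho> \<subseteq> \<mu>}. \<rho> \<union> (\<mu> - \<rho>) = \<mu>" by blast
  show "(\<union>) \<rho> ` matchings (A - fst ` \<rho>) (B - snd ` \<rho>) \<subseteq> {\<mu> \<in> matchings A B. \<rho> \<subseteq> \<mu>}"
  proof safe
    fix \<mu> assume \<mu>: "\<mu> \<in> matchings (A - fst ` \<rho>) (B - snd ` \<rho>)"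
    show "\<rho> \<union> \<mu> \<in> matchings A B"
    proof (rule matchingsI)
      show "\<rho> \<union> \<mu> \<subseteq> A \<times> B" using \<mu> \<rho> by (auto simp: matchings_def)
      have sep: "a \<notin> fst ` \<rho> \<and> b \<notin> snd ` \<rho>" if "(a, b) \<in> \<mu>" for a b
        using \<mu> that by (auto simp: matchings_def)
      show "b = b'" if "(a, b) \<in> \<rho> \<union> \<mu>" "(a, b') \<in> \<rho> \<union> \<mu>" for a b b'
        using that sep matching_unique_fst[OF \<rho>] matching_unique_fst[OF \<mu>] by (force simp: image_iff)
      show "a = a'" if "(a, b) \<in> \<rho> \<union> \<mu>" "(a', b) \<in> \<rho> \<union> \<mu>" for a a' b
        using that sep matching_unique_snd[OF \<rho>] matching_unique_snd[OF \<mu>] by (force simp: image_iff)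
    qed
  qed
  show "(\<lambda>\<mu>. \<mu> - \<rho>) ` {\<mu> \<in> matchings A B. \<rho> \<subseteq> \<mu>} \<subseteq> matchings (A - fst ` \<rho>) (B - snd ` \<rho>)"
  proof safe
    fix \<mu> assume \<mu>: "\<mu> \<in> matchings A B" and sub: "\<rho> \<subseteq> \<mu>"
    show "\<mu> - \<rho> \<in> matchings (A - fst ` \<rho>) (B - snd ` \<rho>)"
    proof (rule matchingsI)
      show "\<mu> - \<rho> \<subseteq> (A - fst ` \<rho>) \<times> (B - snd ` \<rho>)"
      proof
        fix p assume p: "p \<in> \<mu> - \<rho>"
        obtain a b where ab: "p = (a, b)" by (cases p)
        have "a \<notin> fst ` \<rho>"
        proof
          assume "a \<in> fst ` \<rho>"
          then obtain b' where "(a, b') \<in> \<rho>" by auto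
          with p ab sub matching_unique_fst[OF \<mu>, of a b b'] show False by auto
        qed
        moreover have "b \<notin> snd ` \<rho>"
        proof
          assume "b \<in> snd ` \<rho>"
          then obtain a' where "(a', b) \<in> \<rho>" by auto
          with p ab sub matching_unique_snd[OF \<mu>, of a b a'] show False by auto
        qed
        ultimately show "p \<in> (A - fst ` \<rho>) \<times> (B - snd ` \<rho>)"
          using p ab \<mu> by (auto simp: matchings_def)
      qed
    qed (use matching_unique_fst[OF \<mu>] matching_unique_snd[OF \<mu>] in auto)
  qed
qed

lemma sum_matchings_superset:
  assumes \<rho>: "\<rho> \<in> matchings A B"
  shows "(\<Sum>\<mu> | \<mu> \<in> matchings A B \<and> \<rho> \<subseteq> \<mu>. f \<mu>)
       = (\<Sum>\<mu>\<in>matchings (A - fst ` \<rho>) (B - snd ` \<rho>). f (\<rho> \<union> \<mu>))"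
  using sum.reindex_bij_betw[OF bij_betw_matchings_superset[OF \<rho>], of f] by simp

text \<open>
  This recursion on the left side, according to the partner of the new point \<open>a\<close>, takes the
  place of counting matchings by size in the two evaluations below.
\<close>
lemma sum_matchings_insert:
  assumes fin: "finite A" "finite B" and a: "a \<notin> A"
  shows "(\<Sum>\<mu>\<in>matchings (insert a A) B. f \<mu>)
       = (\<Sum>\<mu>\<in>matchings A B. f \<mu>) + (\<Sum>b\<in>B. \<Sum>\<mu>\<in>matchings A (B - {b}). f (insert (a, b) \<mu>))"
proof -
  let ?M = "matchings (insert a A) B"
  let ?U = "\<lambda>b. {\<mu> \<in> ?M. {(a, b)} \<subseteq> \<mu>}"
  have split: "?M = matchings A B \<union> (\<Union>b\<in>B. ?U b)"
    using a by (auto simp: matchings_def)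
  have finM: "finite ?M" using fin by (intro finite_matchings) auto
  have "(\<Sum>\<mu>\<in>?M. f \<mu>) = (\<Sum>\<mu>\<in>matchings A B. f \<mu>) + (\<Sum>\<mu>\<in>(\<Union>b\<in>B. ?U b). f \<mu>)"
    using fin finM a
    by (subst split, intro sum.union_disjoint finite_matchings) (auto simp: matchings_def)
  also have "(\<Sum>\<mu>\<in>(\<Union>b\<in>B. ?U b). f \<mu>) = (\<Sum>b\<in>B. sum f (?U b))"
  proof (rule sum.UNION_disjoint)
    show "\<forall>i\<in>B. \<forall>j\<in>B. i \<noteq> j \<longrightarrow> ?U i \<inter> ?U j = {}"
      using matching_unique_fst[of _ "insert a A" B] by blast
  qed (use fin finM in auto)
  also have "\<dots> = (\<Sum>b\<in>B. \<Sum>\<mu>\<in>matchings A (B - {b}). f (insert (a, b) \<mu>))"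
  proof (rule sum.cong[OF refl])
    fix b assume b: "b \<in> B"
    have "{(a, b)} \<in> matchings (insert a A) B" using b by (auto simp: matchings_def)
    from sum_matchings_superset[OF this, of f]
    show "sum f (?U b) = (\<Sum>\<mu>\<in>matchings A (B - {b}). f (insert (a, b) \<mu>))"
      using a by simp
  qed
  finally show ?thesis .
qed

lemma matching_insert_card:
  assumes "finite A" "finite B" "a \<notin> A" "\<mu> \<in> matchings A B"
  shows "card (insert (a, b) \<mu>) = Suc (card \<mu>)"
proof -
  have "(a, b) \<notin> \<mu>" using assms by (auto simp: matchings_def)
  then show ?thesis using finite_matching[OF assms(1,2,4)] by simp
qed

text \<open>
  The sum over matchings of size \<open>j\<close> alone would give a Vandermonde convolution; with the
  weights \<open>1 / (j + i)!\<close> the total has a closed form that satisfies the recursion above, because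
  \<open>(p + 1 + i) + q\<close> is the factor by which \<open>(p + q + i)!\<close> grows.
\<close>
lemma sum_matchings_inverse_fact:
  assumes "finite A" "finite B"
  shows "(\<Sum>\<mu>\<in>matchings A B. 1 / fact (card \<mu> + i))
       = (fact (card A + card B + i) / (fact (card A + i) * fact (card B + i)) :: real)"
  using assms
proof (induction A arbitrary: B i rule: finite_induct)
  case empty
  then show ?case by (simp add: matchings_empty_left)
next
  case (insert a A)
  let ?p = "card A" and ?q = "card B"
  have "(\<Sum>b\<in>B. \<Sum>\<mu>\<in>matchings A (B - {b}). 1 / fact (card (insert (a, b) \<mu>) + i))
      = (\<Sum>b\<in>B. (fact (?p + ?q + i) / (fact (?p + i + 1) * fact (?q + i)) :: real))"
  proof (rule sum.cong[OF refl])
    fix b assume b: "b \<in> B"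
    have c: "card (B - {b}) + 1 = ?q" using b insert.prems
      by (metis One_nat_def Suc_eq_plus1 card.remove)
    have "(\<Sum>\<mu>\<in>matchings A (B - {b}). 1 / fact (card (insert (a, b) \<mu>) + i) :: real)
        = (\<Sum>\<mu>\<in>matchings A (B - {b}). 1 / fact (card \<mu> + Suc i))"
      by (rule sum.cong[OF refl], subst matching_insert_card[of A "B - {b}" a])
         (use insert in auto)
    also have "\<dots> = fact (?p + card (B - {b}) + Suc i) /
                     (fact (?p + Suc i) * fact (card (B - {b}) + Suc i))"
      using insert by blast
    also have "\<dots> = fact (?p + ?q + i) / (fact (?p + i + 1) * fact (?q + i))"
      using c by (metis (no_types, lifting) Suc_eq_plus1 add.assoc add_Suc_right add_Suc)
    finally show "(\<Sum>\<mu>\<in>matchings A (B - {b}). 1 / fact (card (insert (a, b) \<mu>) + i) :: real)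
      = fact (?p + ?q + i) / (fact (?p + i + 1) * fact (?q + i))" .
  qed
  also have "\<dots> = real ?q * (fact (?p + ?q + i) / (fact (?p + i + 1) * fact (?q + i)))"
    by simp
  finally have *: "(\<Sum>\<mu>\<in>matchings (insert a A) B. 1 / fact (card \<mu> + i))
     = fact (?p + ?q + i) / (fact (?p + i) * fact (?q + i))
       + real ?q * (fact (?p + ?q + i) / (fact (?p + i + 1) * fact (?q + i)) :: real)"
    using insert by (subst sum_matchings_insert) auto
  have alg: "F / (G * H) + q * (F / (x * G * H)) = (x + q) * F / (x * G * H)"
    if "x > 0" "G > 0" "H > 0" for F G H x q :: real
    using that by (simp add: field_simps)
  have "fact (?p + i + 1) = real (?p + i + 1) * fact (?p + i)"
    by (simp del: of_nat_add)
  moreover have "fact (?p + ?q + i + 1) = (real (?p + i + 1) + real ?q) * fact (?p + ?q + i)"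
    by (simp add: algebra_simps)
  ultimately have "fact (?p + ?q + i) / (fact (?p + i) * fact (?q + i))
       + real ?q * (fact (?p + ?q + i) / (fact (?p + i + 1) * fact (?q + i)))
     = (fact (?p + ?q + i + 1) / (fact (?p + i + 1) * fact (?q + i)) :: real)"
    using alg[of "real (?p + i + 1)" "fact (?p + i)" "fact (?q + i)" "fact (?p + ?q + i)" "real ?q"]
    by (simp del: fact_Suc of_nat_add)
  with * insert show ?case by (simp del: fact_Suc)
qed

lemma card_perfect_matchings:
  assumes "finite A" "finite B" "card A = card B"
  shows "real (card {\<mu> \<in> matchings A B. card \<mu> = card A}) = fact (card A)"
proof -
  have "(\<Sum>\<mu>\<in>matchings A B. if card \<mu> = card A then 1 else 0) = (fact (card A) :: real)"
    using assms
  proof (induction A arbitrary: B rule: finite_induct)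
    case empty
    then show ?case by (simp add: matchings_empty_left)
  next
    case (insert a A)
    have z: "(\<Sum>\<mu>\<in>matchings A B. if card \<mu> = card (insert a A) then 1 else (0::real)) = 0"
      using insert card_matching_le[of A _ B] by (intro sum.neutral) force
    have "(\<Sum>b\<in>B. \<Sum>\<mu>\<in>matchings A (B - {b}).
             if card (insert (a, b) \<mu>) = card (insert a A) then 1 else (0::real))
        = (\<Sum>b\<in>B. fact (card A))"
    proof (rule sum.cong[OF refl])
      fix b assume b: "b \<in> B"
      have "(\<Sum>\<mu>\<in>matchings A (B - {b}).
               if card (insert (a, b) \<mu>) = card (insert a A) then 1 else (0::real))
          = (\<Sum>\<mu>\<in>matchings A (B - {b}). if card \<mu> = card A then 1 else 0)"
        by (rule sum.cong[OF refl], subst matching_insert_card[of A "B - {b}" a])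
           (use insert in auto)
      also have "\<dots> = fact (card A)"
        using insert b by (intro insert.IH) auto
      finally show "(\<Sum>\<mu>\<in>matchings A (B - {b}).
               if card (insert (a, b) \<mu>) = card (insert a A) then 1 else (0::real)) = fact (card A)" .
    qed
    also have "\<dots> = fact (card (insert a A))"
    proof -
      have "card B = Suc (card A)" using insert by simp
      then show ?thesis using insert by (simp add: algebra_simps)
    qed
    finally show ?case using insert z by (subst sum_matchings_insert) auto
  qed
  then show ?thesis
    using finite_matchings[OF assms(1,2)] by (simp add: sum.If_cases Collect_conj_eq)
qed

section \<open>Exchanging points along a matching\<close>

lemma card_supersets_of_size:
  assumes "finite V" "I \<subseteq> V" "card I \<le> k"
  shows "card {s. s \<subseteq> V \<and> card s = k \<and> I \<subseteq> s} = (card V - card I) choose (k - card I)"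
proof -
  have finI: "finite I" using assms by (auto intro: finite_subset)
  have "bij_betw (\<lambda>s. I \<union> s) {s. s \<subseteq> V - I \<and> card s = k - card I} {s. s \<subseteq> V \<and> card s = k \<and> I \<subseteq> s}"
  proof (rule bij_betw_byWitness[where f' = "\<lambda>s. s - I"])
    show "(\<union>) I ` {s. s \<subseteq> V - I \<and> card s = k - card I} \<subseteq> {s. s \<subseteq> V \<and> card s = k \<and> I \<subseteq> s}"
    proof safe
      fix s assume s: "s \<subseteq> V - I" "card s = k - card I"
      have "finite s" using s(1) assms(1) by (auto intro: finite_subset)
      then have "card (I \<union> s) = card I + card s" using s finI by (intro card_Un_disjoint) auto
      then show "card (I \<union> s) = k" using s assms by simp
    qed (use assms in auto)
    show "(\<lambda>s. s - I) ` {s. s \<subseteq> V \<and> card s = k \<and> I \<subseteq> s} \<subseteq> {s. s \<subseteq> V - I \<and> card s = k - card I}"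
      using finI by (auto simp: card_Diff_subset)
  qed auto
  then have "card {s. s \<subseteq> V \<and> card s = k \<and> I \<subseteq> s} = card {s. s \<subseteq> V - I \<and> card s = k - card I}"
    by (simp add: bij_betw_same_card)
  also have "\<dots> = card (V - I) choose (k - card I)"
    using assms by (intro n_subsets) auto
  finally show ?thesis using assms finI by (simp add: card_Diff_subset)
qed

locale swap_setting =
  fixes A B :: "'a set"
  assumes finA: "finite A" and finB: "finite B" and disj: "A \<inter> B = {}"
begin

abbreviation "\<M> \<equiv> matchings A B"
abbreviation "v \<equiv> card A + card B"
abbreviation "blocks \<equiv> real (v choose card B)"

text \<open>
  A block with \<open>x\<close> points in \<open>A\<close> comes from \<open>x!\<close> matchings, all of size \<open>x\<close>.  The factorial
  cancels this multiplicity, so that \<open>wt\<close> is a probability distribution whose image on blocks is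
  uniform.
\<close>
definition wt :: "('a \<times> 'a) set \<Rightarrow> real" where
  "wt \<mu> = 1 / (blocks * fact (card \<mu>))"

lemma finM: "finite \<M>" using finA finB by (rule finite_matchings)

lemma finite_of_M: "\<mu> \<in> \<M> \<Longrightarrow> finite \<mu>" using finA finB by (rule finite_matching)

lemma blocks_pos: "blocks > 0" by (simp add: zero_less_binomial)

lemma wt_pos: "wt \<mu> > 0" using blocks_pos by (simp add: wt_def)

lemma wt_superset:
  assumes \<rho>: "\<rho> \<in> \<M>"
  shows "(\<Sum>\<mu> | \<mu> \<in> \<M> \<and> \<rho> \<subseteq> \<mu>. wt \<mu>) = fact (v - card \<rho>) / fact v"
proof -
  let ?i = "card \<rho>" and ?A = "A - fst ` \<rho>" and ?B = "B - snd ` \<rho>"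
  have sub: "fst ` \<rho> \<subseteq> A" "snd ` \<rho> \<subseteq> B" using \<rho> by (auto simp: matchings_def)
  have cA: "card ?A = card A - ?i" "?i \<le> card A"
    using sub finA card_fst_matching[OF \<rho>]
    by (auto simp: card_Diff_subset finite_subset) (metis card_mono)
  have cB: "card ?B = card B - ?i" "?i \<le> card B"
    using sub finB card_snd_matching[OF \<rho>]
    by (auto simp: card_Diff_subset finite_subset) (metis card_mono)
  have "(\<Sum>\<mu> | \<mu> \<in> \<M> \<and> \<rho> \<subseteq> \<mu>. wt \<mu>) = (\<Sum>\<mu>\<in>matchings ?A ?B. wt (\<rho> \<union> \<mu>))"
    by (rule sum_matchings_superset[OF \<rho>])
  also have "\<dots> = (\<Sum>\<mu>\<in>matchings ?A ?B. (1 / blocks) * (1 / fact (card \<mu> + ?i)))"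
  proof (rule sum.cong[OF refl])
    fix \<mu> assume \<mu>: "\<mu> \<in> matchings ?A ?B"
    have "card (\<rho> \<union> \<mu>) = card \<rho> + card \<mu>"
      using \<mu> finite_of_M[OF \<rho>] finite_matching[OF _ _ \<mu>] finA finB
      by (intro card_Un_disjoint) (force simp: matchings_def)+
    then show "wt (\<rho> \<union> \<mu>) = (1 / blocks) * (1 / fact (card \<mu> + ?i))"
      by (simp add: wt_def add.commute)
  qed
  also have "\<dots> = (1 / blocks) * (fact (card ?A + card ?B + ?i) / (fact (card ?A + ?i) * fact (card ?B + ?i)))"
    using finA finB by (simp only: sum_distrib_left[symmetric] sum_matchings_inverse_fact finite_Diff)
  also have "\<dots> = (1 / blocks) * (fact (v - ?i) / (fact (card A) * fact (card B)))"
    using cA cB by simp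
  also have "\<dots> = fact (v - ?i) / fact v"
    by (simp add: binomial_fact field_simps)
  finally show ?thesis .
qed

lemma swap_subset: "\<mu> \<in> \<M> \<Longrightarrow> swap B \<mu> \<subseteq> A \<union> B"
  by (auto simp: matchings_def swap_def)

lemma swap_Int_left: "\<mu> \<in> \<M> \<Longrightarrow> swap B \<mu> \<inter> A = fst ` \<mu>"
  using disj by (force simp: matchings_def swap_def)

lemma swap_Int_right: "\<mu> \<in> \<M> \<Longrightarrow> B - swap B \<mu> = snd ` \<mu>"
  using disj by (force simp: matchings_def swap_def)

lemma mem_swap_left: "\<mu> \<in> \<M> \<Longrightarrow> j \<in> A \<Longrightarrow> j \<in> swap B \<mu> \<longleftrightarrow> (\<exists>b\<in>B. (j, b) \<in> \<mu>)"
  using disj by (force simp: swap_def matchings_def)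

lemma mem_swap_right: "\<mu> \<in> \<M> \<Longrightarrow> j \<in> B \<Longrightarrow> j \<in> swap B \<mu> \<longleftrightarrow> \<not> (\<exists>a\<in>A. (a, j) \<in> \<mu>)"
  using disj by (force simp: swap_def matchings_def)

lemma card_swap: assumes "\<mu> \<in> \<M>" shows "card (swap B \<mu>) = card B"
proof -
  have sub: "fst ` \<mu> \<subseteq> A" "snd ` \<mu> \<subseteq> B" using assms by (auto simp: matchings_def)
  have "card (swap B \<mu>) = card (B - snd ` \<mu>) + card (fst ` \<mu>)"
    unfolding swap_def using sub disj finA finB
    by (intro card_Un_disjoint) (auto intro: finite_subset)
  also have "\<dots> = card B"
    using sub finB card_mono[OF finB sub(2)] assms
    by (simp add: card_Diff_subset finite_subset card_fst_matching card_snd_matching)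
  finally show ?thesis .
qed

text \<open>
  A matching whose block is \<open>s\<close> pairs all of \<open>s \<inter> A\<close> with all of \<open>B - s\<close>.
\<close>
lemma wt_fibre:
  assumes s: "s \<subseteq> A \<union> B" "card s = card B"
  shows "(\<Sum>\<mu> | \<mu> \<in> \<M> \<and> swap B \<mu> = s. wt \<mu>) = 1 / blocks"
proof -
  let ?A = "s \<inter> A" and ?B = "B - s"
  have fin: "finite s" using s finA finB by (auto intro: finite_subset)
  have "card s = card (s \<inter> A) + card (s \<inter> B)"
    using s(1) disj fin by (subst card_Un_disjoint[symmetric]) (auto intro: arg_cong[where f = card])
  moreover have "card B = card (B - s) + card (s \<inter> B)"
    using finB fin by (subst card_Un_disjoint[symmetric]) (auto intro: arg_cong[where f = card])
  ultimately have cc: "card ?A = card ?B" using s(2) by simp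
  have eq: "{\<mu>. \<mu> \<in> \<M> \<and> swap B \<mu> = s} = {\<mu>. \<mu> \<in> matchings ?A ?B \<and> card \<mu> = card ?A}"
  proof safe
    fix \<mu> assume \<mu>: "\<mu> \<in> \<M>" "s = swap B \<mu>"
    have f: "fst ` \<mu> = swap B \<mu> \<inter> A" "snd ` \<mu> = B - swap B \<mu>"
      using swap_Int_left[OF \<mu>(1)] swap_Int_right[OF \<mu>(1)] by auto
    have "\<mu> \<subseteq> fst ` \<mu> \<times> snd ` \<mu>" by force
    then show "\<mu> \<in> matchings (swap B \<mu> \<inter> A) (B - swap B \<mu>)"
      using \<mu>(1) f by (auto simp: matchings_def)
    show "card \<mu> = card (swap B \<mu> \<inter> A)"
      using f card_fst_matching[OF \<mu>(1)] by simp
  next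
    fix \<mu> assume \<mu>: "\<mu> \<in> matchings ?A ?B" "card \<mu> = card ?A"
    then show "\<mu> \<in> \<M>" by (auto simp: matchings_def)
    have "fst ` \<mu> = ?A"
      using \<mu> card_fst_matching[OF \<mu>(1)] fin
      by (intro card_subset_eq) (auto simp: matchings_def)
    moreover have "snd ` \<mu> = ?B"
      using \<mu> card_snd_matching[OF \<mu>(1)] finB cc
      by (intro card_subset_eq) (auto simp: matchings_def)
    ultimately have e: "swap B \<mu> = (B - ?B) \<union> ?A" by (simp add: swap_def)
    show "x \<in> s" if "x \<in> swap B \<mu>" for x using that e by auto
    show "x \<in> swap B \<mu>" if "x \<in> s" for x using that e s(1) by auto
  qed
  have "(\<Sum>\<mu> | \<mu> \<in> \<M> \<and> swap B \<mu> = s. wt \<mu>)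
      = (\<Sum>\<mu> | \<mu> \<in> matchings ?A ?B \<and> card \<mu> = card ?A. 1 / (blocks * fact (card ?A)))"
    unfolding eq by (rule sum.cong) (auto simp: wt_def)
  also have "\<dots> = real (card {\<mu> \<in> matchings ?A ?B. card \<mu> = card ?A}) * (1 / (blocks * fact (card ?A)))"
    by (simp only: sum_constant)
  also have "real (card {\<mu> \<in> matchings ?A ?B. card \<mu> = card ?A}) = fact (card ?A)"
    by (rule card_perfect_matchings[OF _ _ cc]) (use fin finB in auto)
  also have "fact (card ?A) * (1 / (blocks * fact (card ?A))) = 1 / blocks" by simp
  finally show ?thesis .
qed

lemma wt_covering:
  assumes I: "I \<subseteq> A \<union> B" "card I \<le> card B"
  shows "(\<Sum>\<mu> | \<mu> \<in> \<M> \<and> I \<subseteq> swap B \<mu>. wt \<mu>) = real ((v - card I) choose (card B - card I)) / blocks"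
proof -
  let ?S = "{s. s \<subseteq> A \<union> B \<and> card s = card B \<and> I \<subseteq> s}"
  have fin: "finite ?S"
    by (rule finite_subset[of _ "Pow (A \<union> B)"]) (use finA finB in auto)
  have "(\<Sum>\<mu> | \<mu> \<in> \<M> \<and> I \<subseteq> swap B \<mu>. wt \<mu>)
      = (\<Sum>s\<in>?S. \<Sum>\<mu> | \<mu> \<in> {\<mu> \<in> \<M>. I \<subseteq> swap B \<mu>} \<and> swap B \<mu> = s. wt \<mu>)"
    using finM fin swap_subset card_swap
    by (subst sum.group[where g = "swap B"]) auto
  also have "\<dots> = (\<Sum>s\<in>?S. 1 / blocks)"
  proof (rule sum.cong[OF refl])
    fix s assume s: "s \<in> ?S"
    have "{\<mu>. \<mu> \<in> {\<mu> \<in> \<M>. I \<subseteq> swap B \<mu>} \<and> swap B \<mu> = s} = {\<mu>. \<mu> \<in> \<M> \<and> swap B \<mu> = s}"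
      using s by auto
    then show "(\<Sum>\<mu> | \<mu> \<in> {\<mu> \<in> \<M>. I \<subseteq> swap B \<mu>} \<and> swap B \<mu> = s. wt \<mu>) = 1 / blocks"
      using wt_fibre[of s] s by simp
  qed
  also have "\<dots> = real (card ?S) / blocks" by simp
  also have "card ?S = (v - card I) choose (card B - card I)"
    using card_supersets_of_size[of "A \<union> B" I "card B"] I finA finB disj
    by (simp add: card_Un_disjoint)
  finally show ?thesis .
qed

text \<open>
  Induction on \<open>I\<close>: a point \<open>j \<in> A\<close> lies in the block of \<open>\<mu>\<close> iff exactly one of the pairs
  \<open>(j, b)\<close> belongs to \<open>\<mu>\<close>, and a point \<open>j \<in> B\<close> lies in it iff none of the pairs \<open>(a, j)\<close> does.  Either way
  a condition on one point becomes a signed sum of conditions on one more pair.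
\<close>
lemma vanishing_marginals:
  fixes L :: "('a \<times> 'a) set \<Rightarrow> real"
  assumes L: "\<And>\<rho>. \<rho> \<in> \<M> \<Longrightarrow> card \<rho> \<le> t \<Longrightarrow> (\<Sum>\<mu> | \<mu> \<in> \<M> \<and> \<rho> \<subseteq> \<mu>. L \<mu>) = 0"
    and "finite I" "I \<subseteq> A \<union> B" "\<rho> \<in> \<M>" "card \<rho> + card I \<le> t"
  shows "(\<Sum>\<mu> | \<mu> \<in> \<M> \<and> \<rho> \<subseteq> \<mu> \<and> I \<subseteq> swap B \<mu>. L \<mu>) = 0"
  using assms(2-)
proof (induction I arbitrary: \<rho> rule: finite_induct)
  case empty
  then show ?case using L by simp
next
  case (insert j I)
  let ?K = "\<lambda>\<rho>. {\<mu>. \<mu> \<in> \<M> \<and> \<rho> \<subseteq> \<mu> \<and> I \<subseteq> swap B \<mu>}"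
  have z: "sum L (?K (insert p \<rho>)) = 0" for p
  proof (cases "insert p \<rho> \<in> \<M>")
    case True
    have "card (insert p \<rho>) \<le> Suc (card \<rho>)" by (rule card_insert_le_m1) auto
    then show ?thesis using insert.prems insert.hyps True by (intro insert.IH) auto
  next
    case False
    have "\<mu> \<notin> ?K (insert p \<rho>)" for \<mu>
      using False matching_subset[of \<mu> A B "insert p \<rho>"] by auto
    then have e: "?K (insert p \<rho>) = {}" unfolding set_eq_iff empty_iff by blast
    show ?thesis by (subst e) (rule sum.empty)
  qed
  have z0: "sum L (?K \<rho>) = 0" using insert.prems insert.hyps by (intro insert.IH) auto
  have j: "j \<in> A \<or> j \<in> B" using insert.prems by auto
  then show ?case
  proof
    assume jA: "j \<in> A"
    have "{\<mu>. \<mu> \<in> \<M> \<and> \<rho> \<subseteq> \<mu> \<and> insert j I \<subseteq> swap B \<mu>} = (\<Union>b\<in>B. ?K (insert (j, b) \<rho>))"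
      using mem_swap_left[OF _ jA] by auto
    moreover have "sum L (\<Union>b\<in>B. ?K (insert (j, b) \<rho>)) = (\<Sum>b\<in>B. sum L (?K (insert (j, b) \<rho>)))"
    proof (rule sum.UNION_disjoint)
      show "\<forall>i\<in>B. \<forall>i'\<in>B. i \<noteq> i' \<longrightarrow> ?K (insert (j, i) \<rho>) \<inter> ?K (insert (j, i') \<rho>) = {}"
        using matching_unique_fst[of _ A B j] by auto
    qed (use finB finM in auto)
    ultimately show ?thesis using z by simp
  next
    assume jB: "j \<in> B"
    have "{\<mu>. \<mu> \<in> \<M> \<and> \<rho> \<subseteq> \<mu> \<and> insert j I \<subseteq> swap B \<mu>} = ?K \<rho> - (\<Union>a\<in>A. ?K (insert (a, j) \<rho>))"
      using mem_swap_right[OF _ jB] by auto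
    moreover have "sum L (?K \<rho> - (\<Union>a\<in>A. ?K (insert (a, j) \<rho>)))
        = sum L (?K \<rho>) - sum L (\<Union>a\<in>A. ?K (insert (a, j) \<rho>))"
      using finM by (intro sum_diff) auto
    moreover have "sum L (\<Union>a\<in>A. ?K (insert (a, j) \<rho>)) = (\<Sum>a\<in>A. sum L (?K (insert (a, j) \<rho>)))"
    proof (rule sum.UNION_disjoint)
      show "\<forall>i\<in>A. \<forall>i'\<in>A. i \<noteq> i' \<longrightarrow> ?K (insert (i, j) \<rho>) \<inter> ?K (insert (i', j) \<rho>) = {}"
        using matching_unique_snd[of _ A B _ j] by auto
    qed (use finA finM in auto)
    ultimately show ?thesis using z z0 by simp
  qed
qed

text \<open>
  \<open>vanishing_marginals\<close> is applied to the difference between the counting measure of \<open>T\<close> and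
  \<open>N\<close> times the weight.
\<close>
lemma uniform_matchings_give_design:
  assumes T: "T \<subseteq> \<M>" and inj: "inj_on (swap B) T"
    and cnt: "\<And>\<rho>. \<rho> \<in> \<M> \<Longrightarrow> card \<rho> \<le> t \<Longrightarrow>
           real (card {\<mu> \<in> T. \<rho> \<subseteq> \<mu>}) = real N * (fact (v - card \<rho>) / fact v)"
    and I: "I \<subseteq> A \<union> B" "card I = t" and t: "t \<le> card B"
  shows "real (card {s \<in> swap B ` T. I \<subseteq> s}) = real N * (real ((v - t) choose (card B - t)) / blocks)"
proof -
  define L where "L \<mu> = (if \<mu> \<in> T then 1 else 0) - real N * wt \<mu>" for \<mu>
  have sumT: "(\<Sum>\<mu> | \<mu> \<in> \<M> \<and> P \<mu>. if \<mu> \<in> T then 1 else 0 :: real) = real (card {\<mu> \<in> T. P \<mu>})" for P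
  proof -
    have "{\<mu> \<in> T. P \<mu>} = {\<mu>. \<mu> \<in> \<M> \<and> P \<mu>} \<inter> {\<mu>. \<mu> \<in> T}" using T by auto
    then show ?thesis using finM by (simp add: sum.If_cases)
  qed
  have sumL: "(\<Sum>\<mu> | \<mu> \<in> \<M> \<and> P \<mu>. L \<mu>)
      = real (card {\<mu> \<in> T. P \<mu>}) - real N * (\<Sum>\<mu> | \<mu> \<in> \<M> \<and> P \<mu>. wt \<mu>)" for P
    by (simp add: L_def sum_subtractf sumT sum_distrib_left)
  have finI: "finite I" using I finA finB by (auto intro: finite_subset)
  have "(\<Sum>\<mu> | \<mu> \<in> \<M> \<and> {} \<subseteq> \<mu> \<and> I \<subseteq> swap B \<mu>. L \<mu>) = 0"
  proof (rule vanishing_marginals[where t = t])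
    show "(\<Sum>\<mu> | \<mu> \<in> \<M> \<and> \<rho> \<subseteq> \<mu>. L \<mu>) = 0" if "\<rho> \<in> \<M>" "card \<rho> \<le> t" for \<rho>
      unfolding sumL cnt[OF that] wt_superset[OF that(1)] by simp
  qed (use finI I in auto)
  then have "real (card {\<mu> \<in> T. I \<subseteq> swap B \<mu>}) = real N * (\<Sum>\<mu> | \<mu> \<in> \<M> \<and> I \<subseteq> swap B \<mu>. wt \<mu>)"
    using sumL[of "\<lambda>\<mu>. I \<subseteq> swap B \<mu>"] by simp
  moreover have "{s \<in> swap B ` T. I \<subseteq> s} = swap B ` {\<mu> \<in> T. I \<subseteq> swap B \<mu>}" by auto
  moreover have "card (swap B ` {\<mu> \<in> T. I \<subseteq> swap B \<mu>}) = card {\<mu> \<in> T. I \<subseteq> swap B \<mu>}"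
    by (rule card_image) (rule inj_on_subset[OF inj], auto)
  moreover have "(\<Sum>\<mu> | \<mu> \<in> \<M> \<and> I \<subseteq> swap B \<mu>. wt \<mu>) = real ((v - t) choose (card B - t)) / blocks"
    using wt_covering[OF I(1)] unfolding I(2) using t by blast
  ultimately show ?thesis by (simp only:)
qed

end

section \<open>Switchable gadgets\<close>
definition cube :: "'p set \<Rightarrow> 'p set \<Rightarrow> 'p set set" where
  "cube \<sigma> \<mu> = (\<lambda>C. (\<mu> - \<sigma>) \<union> C) ` Pow \<sigma>"

text \<open>
  One of the two states of a gadget.  The remainder \<open>\<mu> - \<sigma>\<close> is common to all its members; the flag
  \<open>\<epsilon>\<close> says whether the number of pairs of \<open>\<sigma>\<close> that a member omits is even.
\<close>
definition half :: "'p set \<Rightarrow> bool \<Rightarrow> 'p set \<Rightarrow> 'p set set" where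
  "half \<sigma> \<epsilon> \<mu> = (\<lambda>C. (\<mu> - \<sigma>) \<union> C) ` {C. C \<subseteq> \<sigma> \<and> even (card (\<sigma> - C)) = \<epsilon>}"

lemma inj_on_cube: "inj_on (\<lambda>C. (\<mu> - \<sigma>) \<union> C) (Pow \<sigma>)"
  by (rule inj_onI) blast

lemma half_subset_cube: "half \<sigma> \<epsilon> \<mu> \<subseteq> cube \<sigma> \<mu>"
  by (auto simp: half_def cube_def)

lemma cube_subset: "\<sigma> \<subseteq> \<mu> \<Longrightarrow> \<kappa> \<in> cube \<sigma> \<mu> \<Longrightarrow> \<kappa> \<subseteq> \<mu>"
  by (auto simp: cube_def)

lemma finite_cube: "finite \<sigma> \<Longrightarrow> finite (cube \<sigma> \<mu>)"
  by (simp add: cube_def)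

lemma card_cube: "finite \<sigma> \<Longrightarrow> card (cube \<sigma> \<mu>) = 2 ^ card \<sigma>"
  unfolding cube_def by (subst card_image[OF inj_on_cube]) (simp add: card_Pow)

lemma finite_half: "finite \<sigma> \<Longrightarrow> finite (half \<sigma> \<epsilon> \<mu>)"
  using finite_cube half_subset_cube by (rule finite_subset[rotated])

lemma half_empty: "half {} True \<mu> = {\<mu>}"
  by (auto simp: half_def)

lemma card_half_superset:
  "card {\<kappa> \<in> half \<sigma> \<epsilon> \<mu>. \<rho> \<subseteq> \<kappa>} = card {C. C \<subseteq> \<sigma> \<and> even (card (\<sigma> - C)) = \<epsilon> \<and> \<rho> \<subseteq> (\<mu> - \<sigma>) \<union> C}"
proof -
  have "{\<kappa> \<in> half \<sigma> \<epsilon> \<mu>. \<rho> \<subseteq> \<kappa>}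
      = (\<lambda>C. (\<mu> - \<sigma>) \<union> C) ` {C. C \<subseteq> \<sigma> \<and> even (card (\<sigma> - C)) = \<epsilon> \<and> \<rho> \<subseteq> (\<mu> - \<sigma>) \<union> C}"
    by (auto simp: half_def)
  moreover have "inj_on (\<lambda>C. (\<mu> - \<sigma>) \<union> C) {C. C \<subseteq> \<sigma> \<and> even (card (\<sigma> - C)) = \<epsilon> \<and> \<rho> \<subseteq> (\<mu> - \<sigma>) \<union> C}"
    by (rule inj_on_subset[OF inj_on_cube]) auto
  ultimately show ?thesis by (simp only: card_image)
qed

text \<open>
  An alternating sum over the \<open>C\<close> with \<open>\<rho> \<inter> \<sigma> \<subseteq> C \<subseteq> \<sigma>\<close>: if some \<open>p \<in> \<sigma>\<close> is not in \<open>\<rho>\<close>, toggling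
  \<open>p\<close> pairs the even with the odd members, and otherwise \<open>C = \<sigma>\<close> is the only term.
\<close>
lemma half_switch:
  assumes fin: "finite \<sigma>" and sub: "\<sigma> \<subseteq> \<mu>"
  shows "int (card {\<kappa> \<in> half \<sigma> True \<mu>. \<rho> \<subseteq> \<kappa>}) - int (card {\<kappa> \<in> half \<sigma> False \<mu>. \<rho> \<subseteq> \<kappa>})
       = (if \<sigma> \<subseteq> \<rho> \<and> \<rho> \<subseteq> \<mu> then 1 else 0)"
proof -
  define Q where "Q \<epsilon> = {C. C \<subseteq> \<sigma> \<and> even (card (\<sigma> - C)) = \<epsilon> \<and> \<rho> \<subseteq> (\<mu> - \<sigma>) \<union> C}" for \<epsilon>
  have "int (card (Q True)) - int (card (Q False)) = (if \<sigma> \<subseteq> \<rho> \<and> \<rho> \<subseteq> \<mu> then 1 else 0)"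
  proof (cases "\<rho> \<subseteq> \<mu>")
    case False
    then have "Q \<epsilon> = {}" for \<epsilon> using sub by (auto simp: Q_def)
    then show ?thesis using False by simp
  next
    case True
    show ?thesis
    proof (cases "\<sigma> \<subseteq> \<rho>")
      case \<sigma>: True
      have "Q \<epsilon> \<subseteq> {\<sigma>}" for \<epsilon> using \<sigma> by (auto simp: Q_def)
      moreover have "\<sigma> \<in> Q True" "\<sigma> \<notin> Q False" using True by (auto simp: Q_def)
      ultimately have "Q True = {\<sigma>}" "Q False = {}" by blast+
      then show ?thesis using True \<sigma> by simp
    next
      case False
      then obtain p where p: "p \<in> \<sigma>" "p \<notin> \<rho>" by blast
      \<comment> \<open>The toggling involution.\<close>
      define f where "f C = (if p \<in> C then C - {p} else insert p C)" for C
      have par: "even (card (\<sigma> - f C)) \<longleftrightarrow> odd (card (\<sigma> - C))" if "C \<subseteq> \<sigma>" for C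
      proof (cases "p \<in> C")
        case True
        have "\<sigma> - (C - {p}) = insert p (\<sigma> - C)" using p True by auto
        then have "card (\<sigma> - (C - {p})) = card (insert p (\<sigma> - C))" by (rule arg_cong)
        also have "\<dots> = Suc (card (\<sigma> - C))"
          by (rule card_insert_disjoint) (use fin True in auto)
        finally show ?thesis using True by (simp add: f_def)
      next
        case False
        have "\<sigma> - C = insert p (\<sigma> - insert p C)" using p False by auto
        then have "card (\<sigma> - C) = card (insert p (\<sigma> - insert p C))" by (rule arg_cong)
        also have "\<dots> = Suc (card (\<sigma> - insert p C))"
          by (rule card_insert_disjoint) (use fin in auto)
        finally show ?thesis using False by (simp add: f_def)
      qed
      have img: "f C \<in> Q (\<not> \<epsilon>)" if C: "C \<in> Q \<epsilon>" for \<epsilon> C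
      proof -
        have "f C \<subseteq> \<sigma>" "\<rho> \<subseteq> (\<mu> - \<sigma>) \<union> f C" using C p by (auto simp: Q_def f_def)
        moreover have "even (card (\<sigma> - f C)) = (\<not> \<epsilon>)" using par[of C] C by (simp add: Q_def)
        ultimately show ?thesis by (simp add: Q_def)
      qed
      have inv: "f (f C) = C" for C by (auto simp: f_def)
      have "bij_betw f (Q True) (Q False)"
      proof (rule bij_betw_byWitness[where f' = f])
        show "f ` Q True \<subseteq> Q False" using img[of _ True] by auto
        show "f ` Q False \<subseteq> Q True" using img[of _ False] by auto
      qed (simp_all add: inv)
      then have "card (Q True) = card (Q False)" by (rule bij_betw_same_card)
      then show ?thesis using False by simp
    qed
  qed
  then show ?thesis by (simp only: card_half_superset Q_def)
qed

lemma half_Un: "half \<sigma> True \<mu> \<union> half \<sigma> False \<mu> = cube \<sigma> \<mu>"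
  by (auto simp: half_def cube_def)

lemma half_Int: "half \<sigma> True \<mu> \<inter> half \<sigma> False \<mu> = {}"
proof -
  have "half \<sigma> True \<mu> \<inter> half \<sigma> False \<mu> = (\<lambda>C. (\<mu> - \<sigma>) \<union> C) ` ({C. C \<subseteq> \<sigma> \<and> even (card (\<sigma> - C)) = True} \<inter> {C. C \<subseteq> \<sigma> \<and> even (card (\<sigma> - C)) = False})"
    unfolding half_def by (rule inj_on_image_Int[OF inj_on_cube, symmetric]) auto
  also have "\<dots> = {}" by auto
  finally show ?thesis .
qed

lemma card_half:
  assumes "finite \<sigma>" "\<sigma> \<subseteq> \<mu>" "\<sigma> \<noteq> {}"
  shows "card (half \<sigma> \<epsilon> \<mu>) = 2 ^ (card \<sigma> - 1)"
proof -
  have eq: "card (half \<sigma> True \<mu>) = card (half \<sigma> False \<mu>)"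
    using half_switch[OF assms(1,2), of "{}"] assms(3) by simp
  have "card (half \<sigma> True \<mu>) + card (half \<sigma> False \<mu>) = card (cube \<sigma> \<mu>)"
    unfolding half_Un[symmetric] using assms
    by (intro card_Un_disjoint[symmetric]) (auto simp: finite_half half_Int)
  also have "\<dots> = 2 * 2 ^ (card \<sigma> - 1)"
    using assms by (simp add: card_cube power_eq_if[of 2 "card \<sigma>"])
  finally show ?thesis using eq by (cases \<epsilon>) auto
qed

section \<open>Correcting errors level by level\<close>

lemma sum_power_card_Pow:
  fixes x :: int
  assumes "finite X"
  shows "(\<Sum>S\<in>Pow X. x ^ card S) = (x + 1) ^ card X"
  using assms
proof (induction X rule: finite_induct)
  case empty then show ?case by simp
next
  case (insert a X)
  have dis: "Pow X \<inter> insert a ` Pow X = {}" using insert.hyps by auto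
  have inj: "inj_on (insert a) (Pow X)"
    by (rule inj_onI) (metis Diff_insert_absorb PowD insert.hyps(2) subsetD)
  have "(\<Sum>S\<in>insert a ` Pow X. x ^ card S) = (\<Sum>S\<in>Pow X. x * x ^ card S)"
  proof (subst sum.reindex[OF inj], rule sum.cong[OF refl])
    fix S assume S: "S \<in> Pow X"
    then have "finite S" "a \<notin> S" using insert.hyps by (auto intro: finite_subset)
    then show "((\<lambda>S. x ^ card S) \<circ> insert a) S = x * x ^ card S" by simp
  qed
  then have "(\<Sum>S\<in>Pow (insert a X). x ^ card S) = (\<Sum>S\<in>Pow X. x ^ card S) + x * (\<Sum>S\<in>Pow X. x ^ card S)"
    unfolding Pow_insert using insert.hyps dis
    by (subst sum.union_disjoint) (auto simp: sum_distrib_left)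
  then show ?case using insert by (simp add: algebra_simps)
qed

text \<open>
  Here \<open>d\<close> is the error of the initial counts, and \<open>\<mu> \<sigma> \<epsilon> m\<close> is the matching of the \<open>m\<close>-th
  gadget for \<open>\<sigma>\<close>; it is used \<open>\<bar>n \<sigma>\<bar>\<close> times, with the direction given by the sign of \<open>n \<sigma>\<close>.  A
  gadget that has the even half present can only lower counts, which is why negative \<open>n \<sigma>\<close> uses
  those with flag \<open>True\<close>.
 
  The value \<open>n \<sigma>\<close> is forced by the values at proper subsets.  The bound
  \<open>\<bar>n \<sigma>\<bar> \<le> \<Delta> * (i + 1) ^ i\<close> for \<open>i = card \<sigma>\<close> propagates: smaller subsets contribute at most
  \<open>\<Delta> * i ^ j\<close> for each of the subsets of size \<open>j < i\<close>, and the binomial theorem sums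
  these to \<open>\<Delta> * (i + 1) ^ i\<close> with the term of \<open>\<sigma>\<close> itself to spare.
\<close>
lemma level_correction:
  fixes d :: "'p set \<Rightarrow> int" and \<mu> :: "'p set \<Rightarrow> bool \<Rightarrow> nat \<Rightarrow> 'p set"
  assumes R: "\<And>\<rho>. \<rho> \<in> R \<Longrightarrow> finite \<rho> \<and> card \<rho> \<le> t" "\<And>\<rho> \<sigma>. \<rho> \<in> R \<Longrightarrow> \<sigma> \<subseteq> \<rho> \<Longrightarrow> \<sigma> \<in> R"
    and d0: "d {} = 0" and d: "\<And>\<rho>. \<rho> \<in> R \<Longrightarrow> \<bar>d \<rho>\<bar> \<le> \<Delta>"
    and \<mu>: "\<And>\<sigma> \<epsilon> m. \<sigma> \<in> R \<Longrightarrow> \<sigma> \<noteq> {} \<Longrightarrow> m < M \<Longrightarrow> \<sigma> \<subseteq> \<mu> \<sigma> \<epsilon> m"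
    and M: "\<Delta> * int (t + 1) ^ t \<le> int M"
  shows "\<exists>n :: 'p set \<Rightarrow> int. (\<forall>\<sigma>\<in>R. \<bar>n \<sigma>\<bar> \<le> int M) \<and>
    (\<forall>\<rho>\<in>R. d \<rho> + (\<Sum>\<sigma>\<in>Pow \<rho> - {{}}. sgn (n \<sigma>) *
        int (card {m. m < nat \<bar>n \<sigma>\<bar> \<and> \<rho> \<subseteq> \<mu> \<sigma> (n \<sigma> < 0) m})) = 0)"
proof -
  define c where "c z \<sigma> \<rho> = sgn z * int (card {m. m < nat \<bar>z\<bar> \<and> \<rho> \<subseteq> \<mu> \<sigma> (z < 0) m})" for z :: int and \<sigma> \<rho>
  have c_le: "\<bar>c z \<sigma> \<rho>\<bar> \<le> \<bar>z\<bar>" for z \<sigma> \<rho>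
  proof -
    have "card {m. m < nat \<bar>z\<bar> \<and> \<rho> \<subseteq> \<mu> \<sigma> (z < 0) m} \<le> card {..<nat \<bar>z\<bar>}"
      by (rule card_mono) auto
    then show ?thesis by (auto simp: c_def abs_mult sgn_if)
  qed
  have c_self: "c z \<sigma> \<sigma> = z" if "\<sigma> \<in> R" "\<sigma> \<noteq> {}" "\<bar>z\<bar> \<le> int M" for z \<sigma>
  proof -
    have "\<sigma> \<subseteq> \<mu> \<sigma> (z < 0) m" if "m < nat \<bar>z\<bar>" for m
      using \<mu>[OF \<open>\<sigma> \<in> R\<close> \<open>\<sigma> \<noteq> {}\<close>] that \<open>\<bar>z\<bar> \<le> int M\<close> by auto
    then have "{m. m < nat \<bar>z\<bar> \<and> \<sigma> \<subseteq> \<mu> \<sigma> (z < 0) m} = {..<nat \<bar>z\<bar>}" by auto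
    then show ?thesis by (simp add: c_def mult_sgn_abs)
  qed
  show ?thesis
  proof (cases "R = {}")
    case True then show ?thesis by auto
  next
    case False
    then have ne: "{} \<in> R" using R(2) by blast
    have \<Delta>0: "\<Delta> \<ge> 0" using d[OF ne] by linarith
    have "\<exists>n. \<forall>\<rho>\<in>R. card \<rho> \<le> l \<longrightarrow> \<bar>n \<rho>\<bar> \<le> \<Delta> * int (card \<rho> + 1) ^ card \<rho> \<and>
        d \<rho> + (\<Sum>\<sigma>\<in>Pow \<rho> - {{}}. c (n \<sigma>) \<sigma> \<rho>) = 0" for l
    proof (induction l)
      case 0
      have "\<bar>0\<bar> \<le> \<Delta> * int (card \<rho> + 1) ^ card \<rho> \<and> d \<rho> + (\<Sum>\<sigma>\<in>Pow \<rho> - {{}}. c 0 \<sigma> \<rho>) = 0"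
        if "\<rho> \<in> R" "card \<rho> \<le> 0" for \<rho>
      proof -
        have "\<rho> = {}" using that R(1) by auto
        then show ?thesis using d0 \<Delta>0 by simp
      qed
      then show ?case by (intro exI[of _ "\<lambda>_. 0"]) blast
    next
      case (Suc l)
      then obtain n where n: "\<And>\<rho>. \<rho> \<in> R \<Longrightarrow> card \<rho> \<le> l \<Longrightarrow> \<bar>n \<rho>\<bar> \<le> \<Delta> * int (card \<rho> + 1) ^ card \<rho>"
        "\<And>\<rho>. \<rho> \<in> R \<Longrightarrow> card \<rho> \<le> l \<Longrightarrow> d \<rho> + (\<Sum>\<sigma>\<in>Pow \<rho> - {{}}. c (n \<sigma>) \<sigma> \<rho>) = 0" by blast
      \<comment> \<open>On level \<open>Suc l\<close>, cancel what is left after all switches for proper subsets.\<close>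
      define n' where "n' \<sigma> = (if card \<sigma> = Suc l then - (d \<sigma> + (\<Sum>\<sigma>'\<in>Pow \<sigma> - {{}, \<sigma>}. c (n \<sigma>') \<sigma>' \<sigma>)) else n \<sigma>)" for \<sigma>
      have new: "\<bar>n' \<rho>\<bar> \<le> \<Delta> * int (card \<rho> + 1) ^ card \<rho> \<and> d \<rho> + (\<Sum>\<sigma>\<in>Pow \<rho> - {{}}. c (n' \<sigma>) \<sigma> \<rho>) = 0"
        if \<rho>: "\<rho> \<in> R" "card \<rho> = Suc l" for \<rho>
      proof -
        have fin: "finite \<rho>" and ct: "card \<rho> \<le> t" using R(1)[OF \<rho>(1)] by auto
        have \<rho>0: "\<rho> \<noteq> {}" using \<rho> by auto
        have sub: "\<sigma> \<in> R \<and> card \<sigma> \<le> l" if "\<sigma> \<in> Pow \<rho> - {{}, \<rho>}" for \<sigma>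
        proof -
          have "\<sigma> \<subset> \<rho>" using that by auto
          then show ?thesis
            using R(2)[OF \<rho>(1), of \<sigma>] psubset_card_mono[OF fin, of \<sigma>] \<rho>(2) by auto
        qed
        have n'\<rho>: "n' \<rho> = - (d \<rho> + (\<Sum>\<sigma>\<in>Pow \<rho> - {{}, \<rho>}. c (n \<sigma>) \<sigma> \<rho>))"
          unfolding n'_def using \<rho>(2) by (simp only: if_True simp_thms)
        then have "\<bar>n' \<rho>\<bar> \<le> \<bar>d \<rho>\<bar> + (\<Sum>\<sigma>\<in>Pow \<rho> - {{}, \<rho>}. \<bar>c (n \<sigma>) \<sigma> \<rho>\<bar>)"
          using sum_abs[of "\<lambda>\<sigma>. c (n \<sigma>) \<sigma> \<rho>" "Pow \<rho> - {{}, \<rho>}"] by linarith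
        also have "\<dots> \<le> \<Delta> + (\<Sum>\<sigma>\<in>Pow \<rho> - {{}, \<rho>}. \<Delta> * int (l + 1) ^ card \<sigma>)"
        proof (intro add_mono d[OF \<rho>(1)] sum_mono)
          fix \<sigma> assume \<sigma>: "\<sigma> \<in> Pow \<rho> - {{}, \<rho>}"
          have "\<bar>c (n \<sigma>) \<sigma> \<rho>\<bar> \<le> \<bar>n \<sigma>\<bar>" by (rule c_le)
          also have "\<dots> \<le> \<Delta> * int (card \<sigma> + 1) ^ card \<sigma>" using sub[OF \<sigma>] n(1) by blast
          also have "\<dots> \<le> \<Delta> * int (l + 1) ^ card \<sigma>"
            using sub[OF \<sigma>] \<Delta>0 by (intro mult_left_mono power_mono) auto
          finally show "\<bar>c (n \<sigma>) \<sigma> \<rho>\<bar> \<le> \<Delta> * int (l + 1) ^ card \<sigma>" .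
        qed
        also have "\<dots> = \<Delta> * (1 + (\<Sum>\<sigma>\<in>Pow \<rho> - {{}, \<rho>}. int (l + 1) ^ card \<sigma>))"
          by (simp add: sum_distrib_left algebra_simps)
        also have "1 + (\<Sum>\<sigma>\<in>Pow \<rho> - {{}, \<rho>}. int (l + 1) ^ card \<sigma>) \<le> int (card \<rho> + 1) ^ card \<rho>"
        proof -
          have "(\<Sum>\<sigma>\<in>Pow \<rho>. int (l + 1) ^ card \<sigma>)
              = (\<Sum>\<sigma>\<in>Pow \<rho> - {{}, \<rho>}. int (l + 1) ^ card \<sigma>) + (\<Sum>\<sigma>\<in>{{}, \<rho>}. int (l + 1) ^ card \<sigma>)"
            using fin by (intro sum.subset_diff) auto
          moreover have "(\<Sum>\<sigma>\<in>{{}, \<rho>}. int (l + 1) ^ card \<sigma>) = 1 + int (l + 1) ^ card \<rho>"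
            using \<rho>0 by auto
          moreover have "(\<Sum>\<sigma>\<in>Pow \<rho>. int (l + 1) ^ card \<sigma>) = int (card \<rho> + 1) ^ card \<rho>"
            using sum_power_card_Pow[OF fin, of "int (l + 1)"] \<rho>(2) by (simp add: add.commute)
          moreover have "int (l + 1) ^ card \<rho> \<ge> 0" by simp
          ultimately show ?thesis by linarith
        qed
        finally have b: "\<bar>n' \<rho>\<bar> \<le> \<Delta> * int (card \<rho> + 1) ^ card \<rho>" using \<Delta>0 by (simp add: mult_left_mono)
        have "int (card \<rho> + 1) ^ card \<rho> \<le> int (t + 1) ^ card \<rho>" using ct by (intro power_mono) auto
        also have "\<dots> \<le> int (t + 1) ^ t" using ct by (intro power_increasing) auto
        finally have "\<Delta> * int (card \<rho> + 1) ^ card \<rho> \<le> \<Delta> * int (t + 1) ^ t"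
          using \<Delta>0 by (rule mult_left_mono)
        then have bM: "\<bar>n' \<rho>\<bar> \<le> int M" using b M by linarith
        have "Pow \<rho> - {{}} = insert \<rho> (Pow \<rho> - {{}, \<rho>})" using \<rho>0 by auto
        then have "(\<Sum>\<sigma>\<in>Pow \<rho> - {{}}. c (n' \<sigma>) \<sigma> \<rho>)
            = (\<Sum>\<sigma>\<in>insert \<rho> (Pow \<rho> - {{}, \<rho>}). c (n' \<sigma>) \<sigma> \<rho>)" by (rule arg_cong)
        moreover have "\<dots> = c (n' \<rho>) \<rho> \<rho> + (\<Sum>\<sigma>\<in>Pow \<rho> - {{}, \<rho>}. c (n' \<sigma>) \<sigma> \<rho>)"
          using fin by (intro sum.insert) auto
        moreover have "c (n' \<rho>) \<rho> \<rho> = n' \<rho>" by (rule c_self[OF \<rho>(1) \<rho>0 bM])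
        moreover have "(\<Sum>\<sigma>\<in>Pow \<rho> - {{}, \<rho>}. c (n' \<sigma>) \<sigma> \<rho>) = (\<Sum>\<sigma>\<in>Pow \<rho> - {{}, \<rho>}. c (n \<sigma>) \<sigma> \<rho>)"
        proof (rule sum.cong[OF refl])
          fix \<sigma> assume "\<sigma> \<in> Pow \<rho> - {{}, \<rho>}"
          then have "card \<sigma> \<le> l" using sub by blast
          then show "c (n' \<sigma>) \<sigma> \<rho> = c (n \<sigma>) \<sigma> \<rho>" by (simp add: n'_def)
        qed
        ultimately have "d \<rho> + (\<Sum>\<sigma>\<in>Pow \<rho> - {{}}. c (n' \<sigma>) \<sigma> \<rho>) = 0"
          using n'\<rho> by linarith
        with b show ?thesis by blast
      qed
      have old: "\<bar>n' \<rho>\<bar> \<le> \<Delta> * int (card \<rho> + 1) ^ card \<rho> \<and> d \<rho> + (\<Sum>\<sigma>\<in>Pow \<rho> - {{}}. c (n' \<sigma>) \<sigma> \<rho>) = 0"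
        if \<rho>: "\<rho> \<in> R" "card \<rho> \<le> l" for \<rho>
      proof -
        have "(\<Sum>\<sigma>\<in>Pow \<rho> - {{}}. c (n' \<sigma>) \<sigma> \<rho>) = (\<Sum>\<sigma>\<in>Pow \<rho> - {{}}. c (n \<sigma>) \<sigma> \<rho>)"
        proof (rule sum.cong[OF refl])
          fix \<sigma> assume "\<sigma> \<in> Pow \<rho> - {{}}"
          then have "card \<sigma> \<le> card \<rho>" using R(1)[OF \<rho>(1)] by (intro card_mono) auto
          then show "c (n' \<sigma>) \<sigma> \<rho> = c (n \<sigma>) \<sigma> \<rho>" using \<rho> by (simp add: n'_def)
        qed
        then show ?thesis using n[OF \<rho>] \<rho> by (simp add: n'_def)
      qed
      show ?case using new old by (intro exI[of _ n']) (auto simp: le_Suc_eq)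
    qed
    then obtain n where n: "\<And>\<rho>. \<rho> \<in> R \<Longrightarrow> \<bar>n \<rho>\<bar> \<le> \<Delta> * int (card \<rho> + 1) ^ card \<rho>"
      "\<And>\<rho>. \<rho> \<in> R \<Longrightarrow> d \<rho> + (\<Sum>\<sigma>\<in>Pow \<rho> - {{}}. c (n \<sigma>) \<sigma> \<rho>) = 0"
      using R(1) by meson
    have "\<bar>n \<rho>\<bar> \<le> int M" if \<rho>: "\<rho> \<in> R" for \<rho>
    proof -
      have ct: "card \<rho> \<le> t" using R(1)[OF \<rho>] by auto
      have "int (card \<rho> + 1) ^ card \<rho> \<le> int (t + 1) ^ card \<rho>" using ct by (intro power_mono) auto
      also have "\<dots> \<le> int (t + 1) ^ t" using ct by (intro power_increasing) auto
      finally have "\<Delta> * int (card \<rho> + 1) ^ card \<rho> \<le> \<Delta> * int (t + 1) ^ t"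
        using \<Delta>0 by (rule mult_left_mono)
      then show ?thesis using n(1)[OF \<rho>] M by linarith
    qed
    then show ?thesis using n(2) unfolding c_def by blast
  qed
qed

section \<open>Selecting from random choices\<close>

lemma sum_UNION_le:
  fixes p :: "'w \<Rightarrow> real"
  assumes "finite I" and fin: "\<And>i. i \<in> I \<Longrightarrow> finite (S i)"
    and nn: "\<And>i w. i \<in> I \<Longrightarrow> w \<in> S i \<Longrightarrow> p w \<ge> 0"
  shows "sum p (\<Union>i\<in>I. S i) \<le> (\<Sum>i\<in>I. sum p (S i))"
  using assms
proof (induction I rule: finite_induct)
  case empty
  then show ?case by simp
next
  case (insert i I)
  let ?T = "\<Union>j\<in>I. S j"
  have "sum p (S i \<union> ?T) = sum p (S i) + sum p ?T - sum p (S i \<inter> ?T)"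
    using insert.hyps insert.prems(1) by (intro sum_Un) auto
  moreover have "sum p (S i \<inter> ?T) \<ge> 0" using insert.prems(2) by (intro sum_nonneg) auto
  moreover have "sum p ?T \<le> (\<Sum>j\<in>I. sum p (S j))"
    using insert.prems by (intro insert.IH) auto
  ultimately show ?case using insert.hyps by simp
qed

text \<open>
  Markov's inequality on the outcomes that are not bad, whose probability is at least \<open>1 - e\<close>.
\<close>
lemma weighted_average_avoiding:
  fixes p f :: "'w \<Rightarrow> real"
  assumes "finite \<Omega>" "\<And>w. w \<in> \<Omega> \<Longrightarrow> p w \<ge> 0" "sum p \<Omega> = 1"
    and bad: "sum p {w \<in> \<Omega>. bad w} \<le> e" and e: "e < 1"
    and f: "\<And>w. w \<in> \<Omega> \<Longrightarrow> f w \<ge> 0" and mean: "(\<Sum>w\<in>\<Omega>. p w * f w) \<le> m"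
  shows "\<exists>w\<in>\<Omega>. \<not> bad w \<and> f w \<le> m / (1 - e)"
proof (rule ccontr)
  assume "\<not> ?thesis"
  then have big: "f w > m / (1 - e)" if "w \<in> \<Omega>" "\<not> bad w" for w using that by force
  let ?G = "{w \<in> \<Omega>. \<not> bad w}"
  have "sum p \<Omega> = sum p ?G + sum p {w \<in> \<Omega>. bad w}"
    using assms(1) by (subst sum.union_disjoint[symmetric]) (auto intro: sum.cong)
  then have G: "sum p ?G \<ge> 1 - e" using assms(3) bad by simp
  have m0: "m \<ge> 0"
    using mean sum_nonneg[of \<Omega> "\<lambda>w. p w * f w"] assms(2) f by force
  have "(\<Sum>w\<in>?G. p w * (f w - m / (1 - e))) > 0"
  proof -
    have "\<exists>w\<in>?G. p w > 0"
    proof (rule ccontr)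
      assume "\<not> (\<exists>w\<in>?G. p w > 0)"
      then have "sum p ?G \<le> 0" by (intro sum_nonpos) force
      then show False using G e by simp
    qed
    then obtain w where w: "w \<in> ?G" "p w > 0" by blast
    show ?thesis
    proof (rule sum_pos2[of _ w])
      show "0 < p w * (f w - m / (1 - e))" using w big by simp
      show "0 \<le> p i * (f i - m / (1 - e))" if "i \<in> ?G" for i
        using that assms(2) big[of i] by (intro mult_nonneg_nonneg) auto
    qed (use assms w in auto)
  qed
  then have "(\<Sum>w\<in>?G. p w * f w) > m / (1 - e) * sum p ?G"
    by (simp add: right_diff_distrib sum_subtractf sum_distrib_left mult.commute)
  moreover have "m / (1 - e) * sum p ?G \<ge> m / (1 - e) * (1 - e)"
    using G m0 e by (intro mult_left_mono) auto
  moreover have "m / (1 - e) * (1 - e) = m" using e by simp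
  moreover have "(\<Sum>w\<in>?G. p w * f w) \<le> (\<Sum>w\<in>\<Omega>. p w * f w)"
    using assms by (intro sum_mono2) auto
  ultimately show False using mean by linarith
qed

text \<open>
  The centred increment has mean zero, so only its variance adds to the sum of squares.
\<close>
lemma second_moment_step:
  fixes p :: "'w \<Rightarrow> real" and x :: "'w \<Rightarrow> 's \<Rightarrow> real"
  assumes p: "sum p \<Omega> = 1" "\<And>w. w \<in> \<Omega> \<Longrightarrow> p w \<ge> 0"
    and V: "\<And>w. w \<in> \<Omega> \<Longrightarrow> (\<Sum>s\<in>R. (x w s)\<^sup>2) \<le> V"
  shows "(\<Sum>w\<in>\<Omega>. p w * (\<Sum>s\<in>R. (D s + (x w s - (\<Sum>w\<in>\<Omega>. p w * x w s)))\<^sup>2)) \<le> (\<Sum>s\<in>R. (D s)\<^sup>2) + V"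
proof -
  define m where "m s = (\<Sum>w\<in>\<Omega>. p w * x w s)" for s
  have "(\<Sum>w\<in>\<Omega>. p w * (\<Sum>s\<in>R. (D s + (x w s - m s))\<^sup>2))
      = (\<Sum>s\<in>R. \<Sum>w\<in>\<Omega>. p w * (D s + (x w s - m s))\<^sup>2)"
    by (simp add: sum_distrib_left sum.swap[of _ \<Omega>])
  also have "\<dots> = (\<Sum>s\<in>R. (D s)\<^sup>2 - (m s)\<^sup>2 + (\<Sum>w\<in>\<Omega>. p w * (x w s)\<^sup>2))"
  proof (rule sum.cong[OF refl])
    fix s
    have "(\<Sum>w\<in>\<Omega>. p w * (D s + (x w s - m s))\<^sup>2)
        = (\<Sum>w\<in>\<Omega>. p w * (D s - m s)\<^sup>2 + 2 * (D s - m s) * (p w * x w s) + p w * (x w s)\<^sup>2)"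
      by (rule sum.cong) (auto simp: power2_eq_square algebra_simps)
    also have "\<dots> = (D s - m s)\<^sup>2 + 2 * (D s - m s) * m s + (\<Sum>w\<in>\<Omega>. p w * (x w s)\<^sup>2)"
      using p(1) by (simp add: sum.distrib sum_distrib_right[symmetric] sum_distrib_left[symmetric] m_def)
    also have "\<dots> = (D s)\<^sup>2 - (m s)\<^sup>2 + (\<Sum>w\<in>\<Omega>. p w * (x w s)\<^sup>2)"
      by (simp add: power2_eq_square algebra_simps)
    finally show "(\<Sum>w\<in>\<Omega>. p w * (D s + (x w s - m s))\<^sup>2) = (D s)\<^sup>2 - (m s)\<^sup>2 + (\<Sum>w\<in>\<Omega>. p w * (x w s)\<^sup>2)" .
  qed
  also have "\<dots> \<le> (\<Sum>s\<in>R. (D s)\<^sup>2 + (\<Sum>w\<in>\<Omega>. p w * (x w s)\<^sup>2))"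
    by (intro sum_mono) auto
  also have "\<dots> = (\<Sum>s\<in>R. (D s)\<^sup>2) + (\<Sum>w\<in>\<Omega>. p w * (\<Sum>s\<in>R. (x w s)\<^sup>2))"
    by (simp add: sum.distrib sum_distrib_left sum.swap[of _ \<Omega>])
  also have "(\<Sum>w\<in>\<Omega>. p w * (\<Sum>s\<in>R. (x w s)\<^sup>2)) \<le> (\<Sum>w\<in>\<Omega>. p w * V)"
    using p V by (intro sum_mono mult_left_mono) auto
  also have "\<dots> = V" using p(1) by (simp add: sum_distrib_right[symmetric])
  finally show ?thesis by (simp add: m_def)
qed

text \<open>
  A derandomized form of the statement that independent choices \<open>w\<close> with law \<open>P g\<close> have disjoint
  sets \<open>Bl g w\<close> and total variance at most twice its expected value.  At each step the outcomes that
  meet an earlier set have probability at most \<open>e = n * \<beta> * \<delta>\<close>.  Some other outcome is at most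
  \<open>1 / (1 - e)\<close> times the average; over \<open>n\<close> steps this loses a factor at most \<open>2\<close>.
\<close>
lemma greedy_selection:
  fixes P :: "'i \<Rightarrow> 'w \<Rightarrow> real" and X :: "'i \<Rightarrow> 'w \<Rightarrow> 's \<Rightarrow> real" and Bl :: "'i \<Rightarrow> 'w \<Rightarrow> 'b set"
  assumes J: "finite J" and \<Omega>: "\<And>g. g \<in> J \<Longrightarrow> finite (\<Omega> g)"
    and P: "\<And>g w. g \<in> J \<Longrightarrow> w \<in> \<Omega> g \<Longrightarrow> P g w \<ge> 0" "\<And>g. g \<in> J \<Longrightarrow> sum (P g) (\<Omega> g) = 1"
    and V: "\<And>g w. g \<in> J \<Longrightarrow> w \<in> \<Omega> g \<Longrightarrow> (\<Sum>s\<in>R. (X g w s)\<^sup>2) \<le> V"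
    and Bl: "\<And>g w. g \<in> J \<Longrightarrow> w \<in> \<Omega> g \<Longrightarrow> finite (Bl g w)"
      "\<And>g w. g \<in> J \<Longrightarrow> w \<in> \<Omega> g \<Longrightarrow> card (Bl g w) \<le> \<beta>"
    and \<delta>: "\<And>g b. g \<in> J \<Longrightarrow> sum (P g) {w \<in> \<Omega> g. b \<in> Bl g w} \<le> \<delta>" and \<delta>0: "\<delta> \<ge> 0"
    and few: "real (card J) * (real (card J) * real \<beta> * \<delta>) \<le> 1/2"
  shows "\<exists>sel. (\<forall>g\<in>J. sel g \<in> \<Omega> g)
    \<and> (\<forall>g\<in>J. \<forall>h\<in>J. g \<noteq> h \<longrightarrow> Bl g (sel g) \<inter> Bl h (sel h) = {})
    \<and> (\<Sum>s\<in>R. (\<Sum>g\<in>J. X g (sel g) s - (\<Sum>w\<in>\<Omega> g. P g w * X g w s))\<^sup>2) \<le> 2 * real (card J) * V"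
proof (cases "J = {}")
  case True then show ?thesis by simp
next
  case False
  define n where "n = card J"
  define e where "e = real n * real \<beta> * \<delta>"
  have n: "n > 0" using False J by (simp add: n_def card_gt_0_iff)
  have e0: "e \<ge> 0" using \<delta>0 by (simp add: e_def)
  have ne: "real n * e \<le> 1/2" using few by (simp add: n_def e_def)
  have "e \<le> real n * e" using n e0 by (simp add: mult_le_cancel_right1)
  then have e1: "e \<le> 1/2" using ne by linarith
  have V0: "V \<ge> 0"
  proof -
    obtain g where g: "g \<in> J" using False by blast
    have "\<Omega> g \<noteq> {}" using P(2)[OF g] by auto
    then obtain w where "w \<in> \<Omega> g" by blast
    then show ?thesis using V[OF g] sum_nonneg[of R "\<lambda>s. (X g w s)\<^sup>2"] by force
  qed
  define m where "m g s = (\<Sum>w\<in>\<Omega> g. P g w * X g w s)" for g s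
  have ind: "\<exists>sel. (\<forall>g\<in>K. sel g \<in> \<Omega> g)
    \<and> (\<forall>g\<in>K. \<forall>h\<in>K. g \<noteq> h \<longrightarrow> Bl g (sel g) \<inter> Bl h (sel h) = {})
    \<and> (\<Sum>s\<in>R. (\<Sum>g\<in>K. X g (sel g) s - m g s)\<^sup>2) \<le> real (card K) * V / (1 - e) ^ card K"
    if "finite K" "K \<subseteq> J" for K
    using that
  proof (induction K rule: finite_induct)
    case empty then show ?case by simp
  next
    case (insert g K)
    then obtain sel where sel: "\<forall>g\<in>K. sel g \<in> \<Omega> g"
      "\<forall>g\<in>K. \<forall>h\<in>K. g \<noteq> h \<longrightarrow> Bl g (sel g) \<inter> Bl h (sel h) = {}"
      "(\<Sum>s\<in>R. (\<Sum>g\<in>K. X g (sel g) s - m g s)\<^sup>2) \<le> real (card K) * V / (1 - e) ^ card K"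
      by auto
    have g: "g \<in> J" and KJ: "K \<subseteq> J" using insert by auto
    define D where "D s = (\<Sum>g\<in>K. X g (sel g) s - m g s)" for s
    define used where "used = (\<Union>h\<in>K. Bl h (sel h))"
    have finused: "finite used" using insert KJ sel Bl(1) by (auto simp: used_def)
    have cused: "card used \<le> n * \<beta>"
    proof -
      have "card used \<le> (\<Sum>h\<in>K. card (Bl h (sel h)))"
        unfolding used_def by (rule card_UN_le[OF insert.hyps(1)])
      also have "\<dots> \<le> (\<Sum>h\<in>K. \<beta>)" using KJ sel(1) Bl(2) by (intro sum_mono) auto
      also have "\<dots> \<le> n * \<beta>" using card_mono[OF J KJ] by (simp add: n_def)
      finally show ?thesis .
    qed
    have nn: "P g w \<ge> 0" if "w \<in> \<Omega> g" for w using P(1)[OF g that] .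
    have "sum (P g) {w \<in> \<Omega> g. Bl g w \<inter> used \<noteq> {}}
        \<le> sum (P g) (\<Union>b\<in>used. {w \<in> \<Omega> g. b \<in> Bl g w})"
    proof (rule sum_mono2)
      show "finite (\<Union>b\<in>used. {w \<in> \<Omega> g. b \<in> Bl g w})"
        using \<Omega>[OF g] by (rule rev_finite_subset) auto
    qed (use nn in auto)
    also have "\<dots> \<le> (\<Sum>b\<in>used. sum (P g) {w \<in> \<Omega> g. b \<in> Bl g w})"
      using finused \<Omega>[OF g] nn by (intro sum_UNION_le) (auto intro: rev_finite_subset)
    also have "\<dots> \<le> (\<Sum>b\<in>used. \<delta>)" using \<delta>[OF g] by (intro sum_mono)
    also have "\<dots> \<le> e"
    proof -
      have "real (card used) \<le> real (n * \<beta>)" using cused by (simp only: of_nat_le_iff)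
      then have "real (card used) * \<delta> \<le> real (n * \<beta>) * \<delta>" using \<delta>0 by (rule mult_right_mono)
      then show ?thesis by (simp add: e_def)
    qed
    finally have bad: "sum (P g) {w \<in> \<Omega> g. Bl g w \<inter> used \<noteq> {}} \<le> e" .
    have "\<exists>w\<in>\<Omega> g. \<not> (Bl g w \<inter> used \<noteq> {}) \<and>
       (\<Sum>s\<in>R. (D s + (X g w s - m g s))\<^sup>2) \<le> ((\<Sum>s\<in>R. (D s)\<^sup>2) + V) / (1 - e)"
    proof (rule weighted_average_avoiding[OF \<Omega>[OF g] nn P(2)[OF g] bad])
      show "(\<Sum>w\<in>\<Omega> g. P g w * (\<Sum>s\<in>R. (D s + (X g w s - m g s))\<^sup>2)) \<le> (\<Sum>s\<in>R. (D s)\<^sup>2) + V"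
        unfolding m_def by (rule second_moment_step[OF P(2)[OF g] nn V[OF g]])
    qed (use e1 in \<open>auto intro: sum_nonneg\<close>)
    then obtain w where w: "w \<in> \<Omega> g" "Bl g w \<inter> used = {}"
      "(\<Sum>s\<in>R. (D s + (X g w s - m g s))\<^sup>2) \<le> ((\<Sum>s\<in>R. (D s)\<^sup>2) + V) / (1 - e)" by blast
    have r: "(1 - e) ^ card K \<le> 1" "(1 - e) ^ card K > 0"
      using e0 e1 by (auto intro: power_le_one)
    let ?sel = "sel(g := w)"
    have "(\<Sum>s\<in>R. (\<Sum>h\<in>insert g K. X h (?sel h) s - m h s)\<^sup>2) = (\<Sum>s\<in>R. (D s + (X g w s - m g s))\<^sup>2)"
    proof (rule sum.cong[OF refl])
      fix s
      have "(\<Sum>h\<in>K. X h (?sel h) s - m h s) = D s"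
        unfolding D_def using insert.hyps by (intro sum.cong) auto
      then show "(\<Sum>h\<in>insert g K. X h (?sel h) s - m h s)\<^sup>2 = (D s + (X g w s - m g s))\<^sup>2"
        using insert.hyps by (simp add: add.commute)
    qed
    also have "\<dots> \<le> ((\<Sum>s\<in>R. (D s)\<^sup>2) + V) / (1 - e)" by (rule w(3))
    also have "\<dots> \<le> (real (card K) * V / (1 - e) ^ card K + V / (1 - e) ^ card K) / (1 - e)"
      using sel(3) e1 V0 r by (intro divide_right_mono add_mono) (auto simp: D_def mult_imp_div_pos_le le_divide_eq mult_left_le)
    also have "\<dots> = real (card (insert g K)) * V / (1 - e) ^ card (insert g K)"
      using insert.hyps by (simp add: algebra_simps add_divide_distrib)
    finally have "(\<Sum>s\<in>R. (\<Sum>h\<in>insert g K. X h (?sel h) s - m h s)\<^sup>2)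
       \<le> real (card (insert g K)) * V / (1 - e) ^ card (insert g K)" .
    moreover have "\<forall>h\<in>insert g K. ?sel h \<in> \<Omega> h" using sel w by auto
    moreover have "\<forall>h\<in>insert g K. \<forall>h'\<in>insert g K. h \<noteq> h' \<longrightarrow> Bl h (?sel h) \<inter> Bl h' (?sel h') = {}"
      using sel(2) w(2) insert.hyps unfolding used_def by auto
    ultimately show ?case by blast
  qed
  obtain sel where sel: "\<forall>g\<in>J. sel g \<in> \<Omega> g"
    "\<forall>g\<in>J. \<forall>h\<in>J. g \<noteq> h \<longrightarrow> Bl g (sel g) \<inter> Bl h (sel h) = {}"
    "(\<Sum>s\<in>R. (\<Sum>g\<in>J. X g (sel g) s - m g s)\<^sup>2) \<le> real n * V / (1 - e) ^ n"
    using ind[OF J] unfolding n_def by auto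
  \<comment> \<open>By Bernoulli's inequality the accumulated factor is at most 2.\<close>
  have "1 - real n * e \<le> (1 - e) ^ n"
    using Bernoulli_inequality[of "- e" n] e1 by simp
  then have half: "(1 - e) ^ n \<ge> 1/2" using ne by linarith
  have "real n * V / (1 - e) ^ n \<le> real n * V / (1/2)"
    using half V0 by (intro divide_left_mono) auto
  then show ?thesis using sel unfolding m_def n_def by (intro exI[of _ sel]) auto
qed

section \<open>The law of a random gadget\<close>

context swap_setting
begin

lemma wt_antimono: "\<mu> \<in> \<M> \<Longrightarrow> \<kappa> \<subseteq> \<mu> \<Longrightarrow> wt \<mu> \<le> wt \<kappa>"
  unfolding wt_def using blocks_pos finite_of_M
  by (intro divide_left_mono mult_left_mono mult_pos_pos fact_mono card_mono) auto

lemma inj_on_swap_cube: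
  assumes \<mu>: "\<mu> \<in> \<M>" and \<sigma>: "\<sigma> \<subseteq> \<mu>"
  shows "inj_on (swap B) (cube \<sigma> \<mu>)"
proof (rule inj_onI)
  fix \<kappa> \<kappa>' assume k: "\<kappa> \<in> cube \<sigma> \<mu>" "\<kappa>' \<in> cube \<sigma> \<mu>" and eq: "swap B \<kappa> = swap B \<kappa>'"
  have sub: "\<kappa> \<subseteq> \<mu>" "\<kappa>' \<subseteq> \<mu>" using cube_subset[OF \<sigma>] k by auto
  have "\<kappa> \<in> \<M>" "\<kappa>' \<in> \<M>" using sub matching_subset[OF \<mu>] by auto
  then have "fst ` \<kappa> = fst ` \<kappa>'" using eq swap_Int_left by metis
  moreover have "inj_on fst \<mu>" using \<mu> by (simp add: matchings_def)
  ultimately show "\<kappa> = \<kappa>'" using sub by (simp add: inj_on_image_eq_iff)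
qed

lemma wt_fibre_le: "(\<Sum>\<mu> | \<mu> \<in> \<M> \<and> swap B \<mu> = s. wt \<mu>) \<le> 1 / blocks"
proof (cases "s \<subseteq> A \<union> B \<and> card s = card B")
  case True then show ?thesis using wt_fibre by simp
next
  case False
  then have "{\<mu>. \<mu> \<in> \<M> \<and> swap B \<mu> = s} = {}" using swap_subset card_swap by blast
  then show ?thesis by (simp only: sum.empty) simp
qed

text \<open>
  A member \<open>\<kappa>\<close> of a cube determines \<open>\<mu>\<close> up to the choice of \<open>C \<subseteq> \<sigma>\<close>, and \<open>\<mu>\<close> contains \<open>\<kappa>\<close>, hence has
  no larger weight.  So if \<open>\<mu>\<close> is drawn by weight subject to \<open>\<sigma> \<subseteq> \<mu>\<close>, a member of its cube equals \<open>\<kappa>\<close> with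
  probability at most \<open>2 ^ card \<sigma> * v ^ card \<sigma>\<close> times the weight of \<open>\<kappa>\<close>.
\<close>
lemma wt_cube_le:
  assumes "finite \<sigma>"
  shows "(\<Sum>\<mu> | \<mu> \<in> \<M> \<and> \<sigma> \<subseteq> \<mu> \<and> \<kappa> \<in> cube \<sigma> \<mu>. wt \<mu>) \<le> 2 ^ card \<sigma> * wt \<kappa>"
proof -
  let ?S = "{\<mu>. \<mu> \<in> \<M> \<and> \<sigma> \<subseteq> \<mu> \<and> \<kappa> \<in> cube \<sigma> \<mu>}"
  have "?S \<subseteq> (\<lambda>C. (\<kappa> - C) \<union> \<sigma>) ` Pow \<sigma>"
  proof
    fix \<mu> assume "\<mu> \<in> ?S"
    then obtain C where C: "\<sigma> \<subseteq> \<mu>" "C \<subseteq> \<sigma>" "\<kappa> = (\<mu> - \<sigma>) \<union> C" by (auto simp: cube_def)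
    then have "\<mu> = (\<kappa> - C) \<union> \<sigma>" by blast
    then show "\<mu> \<in> (\<lambda>C. (\<kappa> - C) \<union> \<sigma>) ` Pow \<sigma>" using C(2) by blast
  qed
  then have "card ?S \<le> card (Pow \<sigma>)" using assms by (intro surj_card_le) auto
  then have c: "real (card ?S) \<le> 2 ^ card \<sigma>" using assms by (simp add: card_Pow)
  have "(\<Sum>\<mu>\<in>?S. wt \<mu>) \<le> (\<Sum>\<mu>\<in>?S. wt \<kappa>)"
  proof (rule sum_mono)
    fix \<mu> assume "\<mu> \<in> ?S"
    then have "\<mu> \<in> \<M>" "\<kappa> \<subseteq> \<mu>" using cube_subset[of \<sigma> \<mu> \<kappa>] by auto
    then show "wt \<mu> \<le> wt \<kappa>" by (rule wt_antimono)
  qed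
  also have "\<dots> = real (card ?S) * wt \<kappa>" by simp
  also have "\<dots> \<le> 2 ^ card \<sigma> * wt \<kappa>" using c wt_pos[of \<kappa>] by (intro mult_right_mono) auto
  finally show ?thesis .
qed

lemma cube_subset_M: "\<mu> \<in> \<M> \<Longrightarrow> \<sigma> \<subseteq> \<mu> \<Longrightarrow> cube \<sigma> \<mu> \<subseteq> \<M>"
  using cube_subset[of \<sigma> \<mu>] matching_subset[of \<mu> A B] by auto

lemma half_subset_M: "\<mu> \<in> \<M> \<Longrightarrow> \<sigma> \<subseteq> \<mu> \<Longrightarrow> half \<sigma> \<epsilon> \<mu> \<subseteq> \<M>"
  using cube_subset_M[of \<mu> \<sigma>] half_subset_cube[of \<sigma> \<epsilon> \<mu>] by auto

lemma wt_cube_covers_block_le: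
  assumes "finite \<sigma>"
  shows "(\<Sum>\<mu> | \<mu> \<in> \<M> \<and> \<sigma> \<subseteq> \<mu> \<and> s \<in> swap B ` cube \<sigma> \<mu>. wt \<mu>) \<le> 2 ^ card \<sigma> / blocks"
proof -
  let ?K = "{\<kappa>. \<kappa> \<in> \<M> \<and> swap B \<kappa> = s}"
  let ?S = "\<lambda>\<kappa>. {\<mu>. \<mu> \<in> \<M> \<and> \<sigma> \<subseteq> \<mu> \<and> \<kappa> \<in> cube \<sigma> \<mu>}"
  have fin: "finite ?K" "finite (?S \<kappa>)" for \<kappa> using finM by auto
  have "{\<mu>. \<mu> \<in> \<M> \<and> \<sigma> \<subseteq> \<mu> \<and> s \<in> swap B ` cube \<sigma> \<mu>} \<subseteq> (\<Union>\<kappa>\<in>?K. ?S \<kappa>)"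
  proof
    fix \<mu> assume "\<mu> \<in> {\<mu>. \<mu> \<in> \<M> \<and> \<sigma> \<subseteq> \<mu> \<and> s \<in> swap B ` cube \<sigma> \<mu>}"
    then obtain \<kappa> where "\<mu> \<in> \<M>" "\<sigma> \<subseteq> \<mu>" "\<kappa> \<in> cube \<sigma> \<mu>" "s = swap B \<kappa>" by blast
    then show "\<mu> \<in> (\<Union>\<kappa>\<in>?K. ?S \<kappa>)" using cube_subset_M[of \<mu> \<sigma>] by blast
  qed
  then have "(\<Sum>\<mu> | \<mu> \<in> \<M> \<and> \<sigma> \<subseteq> \<mu> \<and> s \<in> swap B ` cube \<sigma> \<mu>. wt \<mu>) \<le> sum wt (\<Union>\<kappa>\<in>?K. ?S \<kappa>)"
    using fin wt_pos by (intro sum_mono2) (auto intro: less_imp_le)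
  also have "\<dots> \<le> (\<Sum>\<kappa>\<in>?K. sum wt (?S \<kappa>))"
    by (rule sum_UNION_le) (use fin wt_pos in \<open>auto intro: less_imp_le\<close>)
  also have "\<dots> \<le> (\<Sum>\<kappa>\<in>?K. 2 ^ card \<sigma> * wt \<kappa>)"
    by (intro sum_mono wt_cube_le assms)
  also have "\<dots> = 2 ^ card \<sigma> * (\<Sum>\<kappa>\<in>?K. wt \<kappa>)" by (simp only: sum_distrib_left)
  also have "\<dots> \<le> 2 ^ card \<sigma> * (1 / blocks)" by (intro mult_left_mono wt_fibre_le) auto
  finally show ?thesis by simp
qed

end

section \<open>Choice of the parameters\<close>

text \<open>
  Such a set is obtained from the empty one in \<open>t\<close> steps, each of which adds an element of \<open>X\<close> or
  does nothing.
\<close>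
lemma card_small_subsets_le:
  assumes "finite X"
  shows "card {S. S \<subseteq> X \<and> card S \<le> t} \<le> (card X + 1) ^ t"
proof (induction t)
  case 0
  have "{S. S \<subseteq> X \<and> card S \<le> 0} = {{}}" using assms by (auto dest: finite_subset)
  then show ?case by simp
next
  case (Suc t)
  let ?F = "{S. S \<subseteq> X \<and> card S \<le> t}"
  let ?f = "\<lambda>(z, S). case z of None \<Rightarrow> S | Some x \<Rightarrow> insert x S"
  have fin: "finite ?F" using assms by simp
  have "{S. S \<subseteq> X \<and> card S \<le> Suc t} \<subseteq> ?f ` (insert None (Some ` X) \<times> ?F)"
  proof
    fix S assume S: "S \<in> {S. S \<subseteq> X \<and> card S \<le> Suc t}"
    show "S \<in> ?f ` (insert None (Some ` X) \<times> ?F)"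
    proof (cases "card S \<le> t")
      case True
      then show ?thesis using S by (intro image_eqI[of _ _ "(None, S)"]) auto
    next
      case False
      then have "S \<noteq> {}" by auto
      then obtain x where x: "x \<in> S" by blast
      have "finite S" using S assms by (auto intro: finite_subset)
      moreover have "card S \<le> Suc t" using S by simp
      ultimately have "card (S - {x}) \<le> t" using x by (simp add: card_Diff_singleton)
      then show ?thesis using S x
        by (intro image_eqI[of _ _ "(Some x, S - {x})"]) auto
    qed
  qed
  then have "card {S. S \<subseteq> X \<and> card S \<le> Suc t} \<le> card (insert None (Some ` X) \<times> ?F)"
    using assms fin by (intro surj_card_le) auto
  also have "\<dots> = (card X + 1) * card ?F"
    using assms by (simp add: card_cartesian_product card_image)
  also have "\<dots> \<le> (card X + 1) * (card X + 1) ^ t" using Suc by (intro mult_le_mono2)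
  finally show ?case by simp
qed

locale design_setting = swap_setting +
  fixes t :: nat
  assumes t_pos: "1 \<le> t" and t_less: "t < v" and many_blocks: "real ((v ^ t) ^ 50) \<le> blocks"
begin

definition q :: nat where "q = v ^ t"

text \<open>
  With \<open>M\<close> copies per gadget the family has at most \<open>4 * M * q ^ 5\<close> matchings, and the sum of the squared
  errors is at most \<open>4 * q ^ 4\<close> times as much.  The errors are thus at most \<open>4 * sqrt M * q powr 4.5\<close>, and
  \<open>M = 16 * q ^ 11\<close> is what makes \<open>q\<close> times this bound equal to \<open>M\<close>.
\<close>
definition copies :: nat where "copies = 16 * q ^ 11"

definition small_matchings :: "('a \<times> 'a) set set" where "small_matchings = {\<rho> \<in> \<M>. card \<rho> \<le> t}"

text \<open>
  The last factor is the falling factorial of \<open>v\<close> of length \<open>t\<close>; it makes all the required counts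
  \<open>num_blocks * (v - i)! / v!\<close> integral.  Because of the factor \<open>4 * q ^ 4\<close>, the gadgets account for at most
  half of the intended weight of every single matching, which leaves a nonnegative rest for the fillers.
\<close>
definition num_blocks :: nat where "num_blocks = 4 * copies * q ^ 4 * (fact v div fact (v - t))"

definition gadgets :: "(('a \<times> 'a) set \<times> bool \<times> nat) set" where
  "gadgets = (small_matchings - {{}}) \<times> UNIV \<times> {..<copies}"

text \<open>
  The weight conditioned on containing \<open>\<sigma>\<close>.
\<close>
definition gadget_prob :: "('a \<times> 'a) set \<Rightarrow> ('a \<times> 'a) set \<Rightarrow> real" where
  "gadget_prob \<sigma> \<mu> = wt \<mu> * (fact v / fact (v - card \<sigma>))"

text \<open>
  The expected number of times that \<open>\<kappa>\<close> is present in the initial halves of the random gadgets.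
\<close>
definition excess :: "('a \<times> 'a) set \<Rightarrow> real" where
  "excess \<kappa> = (\<Sum>(\<sigma>, \<epsilon>, m)\<in>gadgets. \<Sum>\<mu> | \<mu> \<in> \<M> \<and> \<sigma> \<subseteq> \<mu>. gadget_prob \<sigma> \<mu> * (if \<kappa> \<in> half \<sigma> \<epsilon> \<mu> then 1 else 0))"

definition gadget_blocks :: nat where
  "gadget_blocks = (\<Sum>(\<sigma>, \<epsilon>, m)\<in>gadgets. 2 ^ (card \<sigma> - 1))"

definition fillers :: nat where "fillers = num_blocks - gadget_blocks"

text \<open>
  Together with the gadgets, \<open>fillers\<close> matchings with this law have the expected distribution
  \<open>num_blocks * wt\<close>.
\<close>
definition filler_prob :: "('a \<times> 'a) set \<Rightarrow> real" where
  "filler_prob \<kappa> = (real num_blocks * wt \<kappa> - excess \<kappa>) / real fillers"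

lemma v_ge2: "v \<ge> 2" using t_pos t_less by linarith

lemma q_ge2: "q \<ge> 2"
proof -
  have "v ^ 1 \<le> v ^ t" using t_pos v_ge2 by (intro power_increasing) auto
  then show ?thesis using v_ge2 unfolding q_def by simp
qed

lemma falling_eq:
  assumes "i \<le> t" shows "real (fact v div fact (v - i)) = fact v / fact (v - i)"
proof -
  have "(fact (v - i) :: nat) dvd fact v" by (intro fact_dvd) auto
  then show ?thesis by (simp add: real_of_nat_div)
qed

lemma falling_le: assumes "i \<le> t" shows "(fact v / fact (v - i) :: real) \<le> real q"
proof -
  have "fact v div fact (v - i) \<le> v ^ i"
    using assms t_less by (intro fact_div_fact_le_pow) auto
  also have "\<dots> \<le> q" unfolding q_def using assms v_ge2 by (intro power_increasing) auto
  finally have "real (fact v div fact (v - i)) \<le> real q" by (simp only: of_nat_le_iff)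
  then show ?thesis using falling_eq[OF assms] by simp
qed

lemma two_power_le: assumes "i \<le> t" shows "(2::nat) ^ i \<le> q"
proof -
  have "(2::nat) ^ i \<le> v ^ i" using v_ge2 by (intro power_mono) auto
  also have "\<dots> \<le> q" unfolding q_def using assms v_ge2 by (intro power_increasing) auto
  finally show ?thesis .
qed

lemma finite_small_matchings: "finite small_matchings" using finM by (simp add: small_matchings_def)

lemma card_small_matchings_le: "card small_matchings \<le> q ^ 2"
proof -
  have "small_matchings \<subseteq> {S. S \<subseteq> A \<times> B \<and> card S \<le> t}" by (auto simp: small_matchings_def matchings_def)
  then have "card small_matchings \<le> card {S. S \<subseteq> A \<times> B \<and> card S \<le> t}" using finA finB by (intro card_mono) auto
  also have "\<dots> \<le> (card (A \<times> B) + 1) ^ t" using finA finB by (intro card_small_subsets_le) auto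
  also have "\<dots> \<le> (v ^ 2) ^ t"
  proof (rule power_mono)
    \<comment> \<open>There are fewer than \<open>v ^ 2\<close> pairs, so at most \<open>(v ^ 2) ^ t\<close> sets of at most \<open>t\<close> pairs.\<close>
    have "card A * card B + 1 \<le> v ^ 2"
    proof (cases "card A * card B = 0")
      case True
      have "v * v \<ge> 2 * 2" using v_ge2 by (intro mult_mono) auto
      then show ?thesis unfolding True power2_eq_square by linarith
    next
      case False
      then have "card A * card A \<ge> 1" by simp
      moreover have "v ^ 2 = card A * card A + 2 * (card A * card B) + card B * card B"
        by (simp add: power2_eq_square algebra_simps)
      ultimately show ?thesis by linarith
    qed
    then show "card (A \<times> B) + 1 \<le> v ^ 2" by (simp add: card_cartesian_product)
  qed auto
  also have "\<dots> = q ^ 2" unfolding q_def by (simp only: power_mult[symmetric] mult.commute)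
  finally show ?thesis .
qed

lemma finite_gadgets: "finite gadgets" using finite_small_matchings by (simp add: gadgets_def)

lemma gadgetsD:
  assumes "(\<sigma>, \<epsilon>, m) \<in> gadgets"
  shows "\<sigma> \<in> \<M>" "card \<sigma> \<le> t" "\<sigma> \<noteq> {}" "m < copies" "finite \<sigma>" "\<sigma> \<in> small_matchings"
  using assms finite_of_M by (auto simp: gadgets_def small_matchings_def)

lemma card_gadgets_le: "card gadgets \<le> 2 * copies * q ^ 2"
proof -
  have "card gadgets = card (small_matchings - {{}}) * (2 * copies)"
    by (simp add: gadgets_def card_cartesian_product)
  also have "\<dots> \<le> q ^ 2 * (2 * copies)"
    using card_small_matchings_le card_Diff1_le[of small_matchings "{}"] by (intro mult_le_mono1) simp
  finally show ?thesis by (simp add: mult.commute)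
qed

lemma gadget_prob_nonneg: "gadget_prob \<sigma> \<mu> \<ge> 0"
  using wt_pos[of \<mu>] by (simp add: gadget_prob_def)

lemma sum_gadget_prob: "\<sigma> \<in> \<M> \<Longrightarrow> (\<Sum>\<mu> | \<mu> \<in> \<M> \<and> \<sigma> \<subseteq> \<mu>. gadget_prob \<sigma> \<mu>) = 1"
  using wt_superset[of \<sigma>] by (simp add: gadget_prob_def sum_divide_distrib[symmetric] sum_distrib_right[symmetric])

lemma sum_gadget_prob_cube_le:
  assumes "finite \<sigma>" "card \<sigma> \<le> t"
  shows "(\<Sum>\<mu> | \<mu> \<in> \<M> \<and> \<sigma> \<subseteq> \<mu> \<and> \<kappa> \<in> cube \<sigma> \<mu>. gadget_prob \<sigma> \<mu>) \<le> real q ^ 2 * wt \<kappa>"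
proof -
  have "(\<Sum>\<mu> | \<mu> \<in> \<M> \<and> \<sigma> \<subseteq> \<mu> \<and> \<kappa> \<in> cube \<sigma> \<mu>. gadget_prob \<sigma> \<mu>)
      = (\<Sum>\<mu> | \<mu> \<in> \<M> \<and> \<sigma> \<subseteq> \<mu> \<and> \<kappa> \<in> cube \<sigma> \<mu>. wt \<mu>) * (fact v / fact (v - card \<sigma>))"
    by (simp only: gadget_prob_def sum_distrib_right)
  also have "\<dots> \<le> (2 ^ card \<sigma> * wt \<kappa>) * real q"
    using wt_cube_le[OF assms(1), of \<kappa>] falling_le[OF assms(2)] wt_pos[of \<kappa>]
    by (intro mult_mono) auto
  also have "\<dots> \<le> (real q * wt \<kappa>) * real q"
  proof -
    have "real (2 ^ card \<sigma>) \<le> real q" using two_power_le[OF assms(2)] by (simp only: of_nat_le_iff)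
    then show ?thesis using wt_pos[of \<kappa>] by (intro mult_right_mono) auto
  qed
  finally show ?thesis by (simp add: power2_eq_square mult_ac)
qed

lemma sum_gadget_prob_block_le:
  assumes "finite \<sigma>" "card \<sigma> \<le> t"
  shows "(\<Sum>\<mu> | \<mu> \<in> \<M> \<and> \<sigma> \<subseteq> \<mu> \<and> s \<in> swap B ` cube \<sigma> \<mu>. gadget_prob \<sigma> \<mu>) \<le> real q ^ 2 / blocks"
proof -
  have "(\<Sum>\<mu> | \<mu> \<in> \<M> \<and> \<sigma> \<subseteq> \<mu> \<and> s \<in> swap B ` cube \<sigma> \<mu>. gadget_prob \<sigma> \<mu>)
      = (\<Sum>\<mu> | \<mu> \<in> \<M> \<and> \<sigma> \<subseteq> \<mu> \<and> s \<in> swap B ` cube \<sigma> \<mu>. wt \<mu>) * (fact v / fact (v - card \<sigma>))"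
    by (simp only: gadget_prob_def sum_distrib_right)
  also have "\<dots> \<le> (2 ^ card \<sigma> / blocks) * real q"
    using wt_cube_covers_block_le[OF assms(1), of s] falling_le[OF assms(2)]
    by (intro mult_mono) auto
  also have "\<dots> \<le> (real q / blocks) * real q"
  proof -
    have "real (2 ^ card \<sigma>) \<le> real q" using two_power_le[OF assms(2)] by (simp only: of_nat_le_iff)
    then show ?thesis by (intro mult_right_mono divide_right_mono) auto
  qed
  finally show ?thesis by (simp add: power2_eq_square mult_ac)
qed

lemma num_blocks_eq: "real num_blocks = 4 * real copies * real q ^ 4 * (fact v / fact (v - t))"
  using falling_eq[of t] by (simp add: num_blocks_def)

lemma num_blocks_ge: "4 * copies * q ^ 4 \<le> num_blocks"
proof -
  have "fact v div fact (v - t) > (0::nat)" by (simp add: div_greater_zero_iff fact_mono)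
  then show ?thesis unfolding num_blocks_def by (metis One_nat_def Suc_leI mult.right_neutral mult_le_mono2)
qed

lemma num_blocks_pos: "num_blocks > 0"
proof -
  have "4 * copies * q ^ 4 > 0" using q_ge2 by (simp add: copies_def)
  then show ?thesis using num_blocks_ge by linarith
qed

lemma num_blocks_le: "num_blocks \<le> 64 * q ^ 16"
proof -
  have "fact v div fact (v - t) \<le> q"
    using t_less unfolding q_def by (intro fact_div_fact_le_pow) auto
  then have "num_blocks \<le> 4 * copies * q ^ 4 * q" unfolding num_blocks_def by (rule mult_le_mono2)
  also have "\<dots> = 64 * q ^ 16" by (simp add: copies_def power_add[symmetric] power_Suc[symmetric] del: power_Suc) (simp add: power_numeral_reduce)
  finally show ?thesis .
qed

lemma excess_nonneg: "excess \<kappa> \<ge> 0"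
  unfolding excess_def using gadget_prob_nonneg by (intro sum_nonneg) (auto intro!: sum_nonneg)

lemma excess_le: "excess \<kappa> \<le> real num_blocks / 2 * wt \<kappa>"
proof -
  have "excess \<kappa> \<le> (\<Sum>(\<sigma>, \<epsilon>, m)\<in>gadgets. real q ^ 2 * wt \<kappa>)"
    unfolding excess_def
  proof (rule sum_mono, clarify)
    fix \<sigma> \<epsilon> m assume g: "(\<sigma>, \<epsilon>, m) \<in> gadgets"
    have "(\<Sum>\<mu> | \<mu> \<in> \<M> \<and> \<sigma> \<subseteq> \<mu>. gadget_prob \<sigma> \<mu> * (if \<kappa> \<in> half \<sigma> \<epsilon> \<mu> then 1 else 0))
        = (\<Sum>\<mu> | \<mu> \<in> \<M> \<and> \<sigma> \<subseteq> \<mu> \<and> \<kappa> \<in> half \<sigma> \<epsilon> \<mu>. gadget_prob \<sigma> \<mu>)"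
      using finM by (intro sum.mono_neutral_cong_right) auto
    also have "\<dots> \<le> (\<Sum>\<mu> | \<mu> \<in> \<M> \<and> \<sigma> \<subseteq> \<mu> \<and> \<kappa> \<in> cube \<sigma> \<mu>. gadget_prob \<sigma> \<mu>)"
      using finM gadget_prob_nonneg half_subset_cube[of \<sigma> \<epsilon>] by (intro sum_mono2) auto
    also have "\<dots> \<le> real q ^ 2 * wt \<kappa>"
      using gadgetsD[OF g] by (intro sum_gadget_prob_cube_le)
    finally show "(\<Sum>\<mu> | \<mu> \<in> \<M> \<and> \<sigma> \<subseteq> \<mu>. gadget_prob \<sigma> \<mu> * (if \<kappa> \<in> half \<sigma> \<epsilon> \<mu> then 1 else 0)) \<le> real q ^ 2 * wt \<kappa>" .
  qed
  also have "\<dots> = real (card gadgets) * (real q ^ 2 * wt \<kappa>)" by (simp add: case_prod_beta)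
  also have "\<dots> \<le> real (2 * copies * q ^ 2) * (real q ^ 2 * wt \<kappa>)"
  proof -
    have "real (card gadgets) \<le> real (2 * copies * q ^ 2)" using card_gadgets_le by (simp only: of_nat_le_iff)
    then show ?thesis using wt_pos[of \<kappa>] by (intro mult_right_mono) auto
  qed
  also have "\<dots> = real (4 * copies * q ^ 4) / 2 * wt \<kappa>"
    by (simp add: power_numeral_reduce)
  also have "\<dots> \<le> real num_blocks / 2 * wt \<kappa>"
  proof -
    have "real (4 * copies * q ^ 4) \<le> real num_blocks" using num_blocks_ge by (simp only: of_nat_le_iff)
    then show ?thesis using wt_pos[of \<kappa>] by (intro mult_right_mono divide_right_mono) auto
  qed
  finally show ?thesis .
qed

lemma sum_excess:
  "(\<Sum>\<kappa> | \<kappa> \<in> \<M> \<and> Q \<kappa>. excess \<kappa>)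
     = (\<Sum>(\<sigma>, \<epsilon>, m)\<in>gadgets. \<Sum>\<mu> | \<mu> \<in> \<M> \<and> \<sigma> \<subseteq> \<mu>. gadget_prob \<sigma> \<mu> * real (card {\<kappa> \<in> half \<sigma> \<epsilon> \<mu>. Q \<kappa>}))"
proof -
  let ?f = "\<lambda>\<kappa> \<sigma> \<epsilon> \<mu>. gadget_prob \<sigma> \<mu> * (if \<kappa> \<in> half \<sigma> \<epsilon> \<mu> then 1 else 0)"
  have "(\<Sum>\<kappa> | \<kappa> \<in> \<M> \<and> Q \<kappa>. excess \<kappa>)
      = (\<Sum>g\<in>gadgets. \<Sum>\<kappa> | \<kappa> \<in> \<M> \<and> Q \<kappa>. (case g of (\<sigma>, \<epsilon>, m) \<Rightarrow> \<Sum>\<mu> | \<mu> \<in> \<M> \<and> \<sigma> \<subseteq> \<mu>. ?f \<kappa> \<sigma> \<epsilon> \<mu>))"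
    unfolding excess_def by (rule sum.swap)
  also have "\<dots> = (\<Sum>(\<sigma>, \<epsilon>, m)\<in>gadgets. \<Sum>\<mu> | \<mu> \<in> \<M> \<and> \<sigma> \<subseteq> \<mu>. gadget_prob \<sigma> \<mu> * real (card {\<kappa> \<in> half \<sigma> \<epsilon> \<mu>. Q \<kappa>}))"
  proof (rule sum.cong[OF refl], clarify)
    fix \<sigma> \<epsilon> m
    have "(\<Sum>\<kappa> | \<kappa> \<in> \<M> \<and> Q \<kappa>. \<Sum>\<mu> | \<mu> \<in> \<M> \<and> \<sigma> \<subseteq> \<mu>. ?f \<kappa> \<sigma> \<epsilon> \<mu>)
        = (\<Sum>\<mu> | \<mu> \<in> \<M> \<and> \<sigma> \<subseteq> \<mu>. \<Sum>\<kappa> | \<kappa> \<in> \<M> \<and> Q \<kappa>. ?f \<kappa> \<sigma> \<epsilon> \<mu>)" by (rule sum.swap)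
    also have "\<dots> = (\<Sum>\<mu> | \<mu> \<in> \<M> \<and> \<sigma> \<subseteq> \<mu>. gadget_prob \<sigma> \<mu> * real (card {\<kappa> \<in> half \<sigma> \<epsilon> \<mu>. Q \<kappa>}))"
    proof (rule sum.cong[OF refl])
      fix \<mu> assume \<mu>: "\<mu> \<in> {\<mu>. \<mu> \<in> \<M> \<and> \<sigma> \<subseteq> \<mu>}"
      have "{\<kappa>. \<kappa> \<in> \<M> \<and> Q \<kappa>} \<inter> {\<kappa>. \<kappa> \<in> half \<sigma> \<epsilon> \<mu>} = {\<kappa> \<in> half \<sigma> \<epsilon> \<mu>. Q \<kappa>}"
        using half_subset_M[of \<mu> \<sigma> \<epsilon>] \<mu> by auto
      moreover have "(\<Sum>\<kappa> | \<kappa> \<in> \<M> \<and> Q \<kappa>. if \<kappa> \<in> half \<sigma> \<epsilon> \<mu> then 1 else 0 :: real)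
          = real (card ({\<kappa>. \<kappa> \<in> \<M> \<and> Q \<kappa>} \<inter> {\<kappa>. \<kappa> \<in> half \<sigma> \<epsilon> \<mu>}))"
        using finM by (subst sum.If_cases) auto
      ultimately have "(\<Sum>\<kappa> | \<kappa> \<in> \<M> \<and> Q \<kappa>. if \<kappa> \<in> half \<sigma> \<epsilon> \<mu> then 1 else 0 :: real)
          = real (card {\<kappa> \<in> half \<sigma> \<epsilon> \<mu>. Q \<kappa>})" by (simp only:)
      then show "(\<Sum>\<kappa> | \<kappa> \<in> \<M> \<and> Q \<kappa>. ?f \<kappa> \<sigma> \<epsilon> \<mu>) = gadget_prob \<sigma> \<mu> * real (card {\<kappa> \<in> half \<sigma> \<epsilon> \<mu>. Q \<kappa>})"
        by (simp only: sum_distrib_left[symmetric])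
    qed
    finally show "(\<Sum>\<kappa> | \<kappa> \<in> \<M> \<and> Q \<kappa>. \<Sum>\<mu> | \<mu> \<in> \<M> \<and> \<sigma> \<subseteq> \<mu>. ?f \<kappa> \<sigma> \<epsilon> \<mu>)
        = (\<Sum>\<mu> | \<mu> \<in> \<M> \<and> \<sigma> \<subseteq> \<mu>. gadget_prob \<sigma> \<mu> * real (card {\<kappa> \<in> half \<sigma> \<epsilon> \<mu>. Q \<kappa>}))" .
  qed
  finally show ?thesis .
qed

lemma sum_excess_all: "(\<Sum>\<kappa>\<in>\<M>. excess \<kappa>) = real gadget_blocks"
proof -
  have "(\<Sum>\<kappa>\<in>\<M>. excess \<kappa>)
     = (\<Sum>(\<sigma>, \<epsilon>, m)\<in>gadgets. \<Sum>\<mu> | \<mu> \<in> \<M> \<and> \<sigma> \<subseteq> \<mu>. gadget_prob \<sigma> \<mu> * real (card (half \<sigma> \<epsilon> \<mu>)))"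
    using sum_excess[of "\<lambda>_. True"] by simp
  also have "\<dots> = (\<Sum>(\<sigma>, \<epsilon>, m)\<in>gadgets. 2 ^ (card \<sigma> - 1))"
  proof (rule sum.cong[OF refl], clarify)
    fix \<sigma> \<epsilon> m assume g: "(\<sigma>, \<epsilon>, m) \<in> gadgets"
    have "(\<Sum>\<mu> | \<mu> \<in> \<M> \<and> \<sigma> \<subseteq> \<mu>. gadget_prob \<sigma> \<mu> * real (card (half \<sigma> \<epsilon> \<mu>)))
        = (\<Sum>\<mu> | \<mu> \<in> \<M> \<and> \<sigma> \<subseteq> \<mu>. gadget_prob \<sigma> \<mu> * 2 ^ (card \<sigma> - 1))"
      using gadgetsD[OF g] by (intro sum.cong) (auto simp: card_half)
    also have "\<dots> = 2 ^ (card \<sigma> - 1)"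
      using sum_gadget_prob[OF gadgetsD(1)[OF g]] by (simp only: sum_distrib_right[symmetric] mult_1)
    finally show "(\<Sum>\<mu> | \<mu> \<in> \<M> \<and> \<sigma> \<subseteq> \<mu>. gadget_prob \<sigma> \<mu> * real (card (half \<sigma> \<epsilon> \<mu>))) = 2 ^ (card \<sigma> - 1)" .
  qed
  also have "\<dots> = real gadget_blocks" by (simp add: gadget_blocks_def case_prod_beta)
  finally show ?thesis .
qed

lemma sum_wt: "(\<Sum>\<mu>\<in>\<M>. wt \<mu>) = 1"
  using wt_superset[of "{}"] by simp

lemma gadget_blocks_le: "real gadget_blocks \<le> real num_blocks / 2"
proof -
  have "real gadget_blocks \<le> (\<Sum>\<kappa>\<in>\<M>. real num_blocks / 2 * wt \<kappa>)"
    unfolding sum_excess_all[symmetric] by (intro sum_mono excess_le)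
  also have "\<dots> = real num_blocks / 2" using sum_wt by (simp only: sum_distrib_left[symmetric] mult_1_right)
  finally show ?thesis .
qed

lemma fillers_eq: "real fillers = real num_blocks - real gadget_blocks"
  using gadget_blocks_le by (simp add: fillers_def of_nat_diff)

lemma fillers_ge: "real fillers \<ge> real num_blocks / 2" "real fillers > 0" "fillers \<le> num_blocks"
  using fillers_eq gadget_blocks_le num_blocks_pos by (auto simp: fillers_def)

lemma filler_prob_nonneg: "filler_prob \<kappa> \<ge> 0"
proof -
  have "real num_blocks / 2 * wt \<kappa> \<le> real num_blocks * wt \<kappa>" using wt_pos[of \<kappa>] by simp
  then have "0 \<le> real num_blocks * wt \<kappa> - excess \<kappa>" using excess_le[of \<kappa>] by linarith
  then show ?thesis unfolding filler_prob_def by (intro divide_nonneg_nonneg) auto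
qed

lemma filler_prob_le: "filler_prob \<kappa> \<le> 2 * wt \<kappa>"
proof -
  have "real num_blocks * wt \<kappa> - excess \<kappa> \<le> (2 * real fillers) * wt \<kappa>"
    using excess_nonneg[of \<kappa>] fillers_ge(1) wt_pos[of \<kappa>] mult_right_mono[of "real num_blocks" "2 * real fillers" "wt \<kappa>"]
    by linarith
  then show ?thesis using fillers_ge(2) by (simp add: filler_prob_def field_simps)
qed

lemma fillers_sum_filler_prob:
  "real fillers * (\<Sum>\<kappa> | \<kappa> \<in> \<M> \<and> Q \<kappa>. filler_prob \<kappa>)
     = real num_blocks * (\<Sum>\<kappa> | \<kappa> \<in> \<M> \<and> Q \<kappa>. wt \<kappa>) - (\<Sum>\<kappa> | \<kappa> \<in> \<M> \<and> Q \<kappa>. excess \<kappa>)"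
  unfolding filler_prob_def using fillers_ge(2)
  by (simp add: sum_divide_distrib[symmetric] sum_subtractf sum_distrib_left)

lemma sum_filler_prob: "(\<Sum>\<kappa>\<in>\<M>. filler_prob \<kappa>) = 1"
  using fillers_sum_filler_prob[of "\<lambda>_. True"] sum_wt sum_excess_all fillers_eq fillers_ge(2) by simp

end

section \<open>A nearly uniform family of matchings\<close>

context design_setting
begin

text \<open>
  A filler is treated as a gadget with \<open>\<sigma> = {}\<close> and even parity, whose present half is \<open>{\<mu>}\<close>.
\<close>
definition indices :: "(('a \<times> 'a) set \<times> bool \<times> nat) set" where
  "indices = ({{}} \<times> {True} \<times> {..<fillers}) \<union> gadgets"

definition piece :: "('a \<times> 'a) set \<times> bool \<times> nat \<Rightarrow> ('a \<times> 'a) set \<Rightarrow> ('a \<times> 'a) set set" where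
  "piece g \<mu> = half (fst g) (fst (snd g)) \<mu>"

lemma finite_indices: "finite indices"
  using finite_gadgets by (simp add: indices_def)

lemma indicesD:
  assumes "g \<in> indices"
  shows "fst g \<in> \<M>" "card (fst g) \<le> t" "finite (fst g)"
proof -
  have "fst g \<in> \<M> \<and> card (fst g) \<le> t"
    using assms gadgetsD(1,2) by (cases g) (auto simp: indices_def)
  then show "fst g \<in> \<M>" "card (fst g) \<le> t" "finite (fst g)" using finite_of_M by auto
qed

lemma sum_indices:
  "(\<Sum>g\<in>indices. f g) = (\<Sum>m<fillers. f ({}, True, m)) + (\<Sum>g\<in>gadgets. f g)"
proof -
  have "(\<Sum>g\<in>indices. f g) = (\<Sum>g\<in>{{}} \<times> {True} \<times> {..<fillers}. f g) + (\<Sum>g\<in>gadgets. f g)"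
    unfolding indices_def using finite_gadgets by (intro sum.union_disjoint) (auto simp: gadgets_def)
  also have "(\<Sum>g\<in>{{}} \<times> {True} \<times> {..<fillers}. f g) = (\<Sum>m<fillers. f ({}, True, m))"
  proof -
    have "{{} :: ('a \<times> 'a) set} \<times> {True} \<times> {..<fillers} = (\<lambda>m. ({}, True, m)) ` {..<fillers}" by auto
    then show ?thesis by (simp add: sum.reindex inj_on_def)
  qed
  finally show ?thesis .
qed

lemma card_indices_le: "card indices \<le> 2 * num_blocks"
proof -
  have "card indices \<le> card ({{}::('a \<times> 'a) set} \<times> {True} \<times> {..<fillers}) + card gadgets"
    unfolding indices_def by (rule card_Un_le)
  also have "\<dots> = fillers + card gadgets" by (simp add: card_cartesian_product)
  also have "\<dots> \<le> num_blocks + 2 * copies * q ^ 2"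
    using fillers_ge(3) card_gadgets_le by (intro add_mono)
  also have "2 * copies * q ^ 2 \<le> 4 * copies * q ^ 4"
    using q_ge2 by (intro mult_le_mono power_increasing) auto
  also have "4 * copies * q ^ 4 \<le> num_blocks" by (rule num_blocks_ge)
  finally show ?thesis by simp
qed

text \<open>
  \<open>greedy_selection\<close> applied to gadgets and fillers together.  The blocks of both halves are kept
  disjoint, so that they stay distinct whatever is switched later.
\<close>
lemma balanced_default:
  "\<exists>sel. (\<forall>g\<in>indices. sel g \<in> \<M> \<and> fst g \<subseteq> sel g)
    \<and> (\<forall>g\<in>indices. \<forall>h\<in>indices. g \<noteq> h \<longrightarrow>
          swap B ` cube (fst g) (sel g) \<inter> swap B ` cube (fst h) (sel h) = {})
    \<and> (\<forall>\<rho>\<in>small_matchings. \<bar>(\<Sum>g\<in>indices. real (card {\<kappa> \<in> piece g (sel g). \<rho> \<subseteq> \<kappa>}))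
          - real num_blocks * (fact (v - card \<rho>) / fact v)\<bar> \<le> 16 * real q ^ 10)"
proof -
  define \<Omega> where "\<Omega> g = {\<mu> \<in> \<M>. fst g \<subseteq> \<mu>}" for g :: "('a \<times> 'a) set \<times> bool \<times> nat"
  define P where "P g \<mu> = (if fst g = {} then filler_prob \<mu> else gadget_prob (fst g) \<mu>)" for g :: "('a \<times> 'a) set \<times> bool \<times> nat" and \<mu>
  define X where "X g \<mu> \<rho> = real (card {\<kappa> \<in> piece g \<mu>. \<rho> \<subseteq> \<kappa>})" for g :: "('a \<times> 'a) set \<times> bool \<times> nat" and \<mu> \<rho>
  define Bl where "Bl g \<mu> = swap B ` cube (fst g) \<mu>" for g :: "('a \<times> 'a) set \<times> bool \<times> nat" and \<mu>
  have q1: "real q \<ge> 1" using q_ge2 by simp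
  have X_le: "X g \<mu> \<rho> \<le> real q" if g: "g \<in> indices" for g \<mu> \<rho>
  proof -
    have "card {\<kappa> \<in> piece g \<mu>. \<rho> \<subseteq> \<kappa>} \<le> card (cube (fst g) \<mu>)"
      using half_subset_cube[of "fst g" "fst (snd g)" \<mu>] finite_cube[OF indicesD(3)[OF g]]
      by (intro card_mono) (auto simp: piece_def)
    also have "\<dots> = 2 ^ card (fst g)" by (rule card_cube[OF indicesD(3)[OF g]])
    also have "\<dots> \<le> q" by (rule two_power_le[OF indicesD(2)[OF g]])
    finally show ?thesis by (simp add: X_def)
  qed
  have "\<exists>sel. (\<forall>g\<in>indices. sel g \<in> \<Omega> g)
    \<and> (\<forall>g\<in>indices. \<forall>h\<in>indices. g \<noteq> h \<longrightarrow> Bl g (sel g) \<inter> Bl h (sel h) = {})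
    \<and> (\<Sum>\<rho>\<in>small_matchings. (\<Sum>g\<in>indices. X g (sel g) \<rho> - (\<Sum>\<mu>\<in>\<Omega> g. P g \<mu> * X g \<mu> \<rho>))\<^sup>2)
        \<le> 2 * real (card indices) * real q ^ 4"
  proof (rule greedy_selection[where \<beta> = q and \<delta> = "real q ^ 2 / blocks"])
    show "finite indices" by (rule finite_indices)
    show "finite (\<Omega> g)" for g using finM by (simp add: \<Omega>_def)
    show "P g w \<ge> 0" for g w using filler_prob_nonneg gadget_prob_nonneg by (simp add: P_def)
    show "sum (P g) (\<Omega> g) = 1" if "g \<in> indices" for g
      using sum_filler_prob sum_gadget_prob[OF indicesD(1)[OF that]]
      by (cases "fst g = {}") (simp_all add: P_def \<Omega>_def)
    show "(\<Sum>\<rho>\<in>small_matchings. (X g w \<rho>)\<^sup>2) \<le> real q ^ 4" if g: "g \<in> indices" for g w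
    proof -
      have "(\<Sum>\<rho>\<in>small_matchings. (X g w \<rho>)\<^sup>2) \<le> (\<Sum>\<rho>\<in>small_matchings. (real q)\<^sup>2)"
        using X_le[OF g] by (intro sum_mono power_mono) (auto simp: X_def)
      also have "\<dots> = real (card small_matchings) * real q ^ 2" by simp
      also have "\<dots> \<le> real (q ^ 2) * real q ^ 2"
        using card_small_matchings_le by (intro mult_right_mono) (simp_all only: of_nat_le_iff, simp)
      also have "\<dots> = real q ^ 4" by (simp add: power_add[symmetric])
      finally show ?thesis .
    qed
    show "finite (Bl g w)" if "g \<in> indices" for g w
      using finite_cube[OF indicesD(3)[OF that]] by (simp add: Bl_def)
    show "card (Bl g w) \<le> q" if g: "g \<in> indices" for g w
    proof -
      have "card (Bl g w) \<le> card (cube (fst g) w)"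
        unfolding Bl_def by (rule card_image_le[OF finite_cube[OF indicesD(3)[OF g]]])
      also have "\<dots> = 2 ^ card (fst g)" by (rule card_cube[OF indicesD(3)[OF g]])
      also have "\<dots> \<le> q" by (rule two_power_le[OF indicesD(2)[OF g]])
      finally show ?thesis .
    qed
    show "sum (P g) {w \<in> \<Omega> g. b \<in> Bl g w} \<le> real q ^ 2 / blocks" if g: "g \<in> indices" for g b
    proof (cases "fst g = {}")
      case False
      have "{w \<in> \<Omega> g. b \<in> Bl g w} = {\<mu>. \<mu> \<in> \<M> \<and> fst g \<subseteq> \<mu> \<and> b \<in> swap B ` cube (fst g) \<mu>}"
        by (auto simp: \<Omega>_def Bl_def)
      then show ?thesis using sum_gadget_prob_block_le[OF indicesD(3,2)[OF g], of b] False
        by (simp add: P_def)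
    next
      case True
      have "{w \<in> \<Omega> g. b \<in> Bl g w} = {\<mu>. \<mu> \<in> \<M> \<and> swap B \<mu> = b}"
        using True by (auto simp: \<Omega>_def Bl_def cube_def)
      then have "sum (P g) {w \<in> \<Omega> g. b \<in> Bl g w} = (\<Sum>\<mu> | \<mu> \<in> \<M> \<and> swap B \<mu> = b. filler_prob \<mu>)"
        using True by (simp add: P_def)
      also have "\<dots> \<le> (\<Sum>\<mu> | \<mu> \<in> \<M> \<and> swap B \<mu> = b. 2 * wt \<mu>)"
        by (intro sum_mono filler_prob_le)
      also have "\<dots> = 2 * (\<Sum>\<mu> | \<mu> \<in> \<M> \<and> swap B \<mu> = b. wt \<mu>)" by (simp only: sum_distrib_left)
      also have "\<dots> \<le> 2 * (1 / blocks)" by (intro mult_left_mono wt_fibre_le) auto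
      also have "\<dots> \<le> real q ^ 2 / blocks"
      proof -
        have "(2::real) \<le> real q ^ 1" using q_ge2 by simp
        also have "\<dots> \<le> real q ^ 2" using q1 by (intro power_increasing) auto
        finally show ?thesis using blocks_pos by (simp add: divide_right_mono)
      qed
      finally show ?thesis .
    qed
    show "0 \<le> real q ^ 2 / blocks" by simp
    show "real (card indices) * (real (card indices) * real q * (real q ^ 2 / blocks)) \<le> 1 / 2"
    proof -
      \<comment> \<open>Here the size of \<open>v choose k\<close> enters: it makes repeated blocks unlikely.\<close>
      have "card indices * card indices * q ^ 3 * 2 \<le> (2 * num_blocks) * (2 * num_blocks) * q ^ 3 * 2"
        using card_indices_le by (intro mult_le_mono) auto
      also have "\<dots> \<le> (2 * (64 * q ^ 16)) * (2 * (64 * q ^ 16)) * q ^ 3 * 2"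
        using num_blocks_le by (intro mult_le_mono) auto
      also have "\<dots> = 2 ^ 15 * q ^ 35" by (simp add: power_add[symmetric])
      also have "\<dots> \<le> q ^ 15 * q ^ 35" using q_ge2 by (intro mult_le_mono power_mono) auto
      also have "\<dots> = (v ^ t) ^ 50" unfolding q_def by (simp only: power_add[symmetric]) simp
      finally have "real (card indices * card indices * q ^ 3 * 2) \<le> real ((v ^ t) ^ 50)"
        by (simp only: of_nat_le_iff)
      then have "real (card indices * card indices * q ^ 3 * 2) \<le> blocks" using many_blocks by linarith
      then show ?thesis using blocks_pos by (simp add: field_simps power_numeral_reduce)
    qed
  qed
  then obtain sel where sel: "\<forall>g\<in>indices. sel g \<in> \<Omega> g"
    "\<forall>g\<in>indices. \<forall>h\<in>indices. g \<noteq> h \<longrightarrow> Bl g (sel g) \<inter> Bl h (sel h) = {}"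
    "(\<Sum>\<rho>\<in>small_matchings. (\<Sum>g\<in>indices. X g (sel g) \<rho> - (\<Sum>\<mu>\<in>\<Omega> g. P g \<mu> * X g \<mu> \<rho>))\<^sup>2)
        \<le> 2 * real (card indices) * real q ^ 4" by blast
  \<comment> \<open>The law of the fillers was chosen so that the expected counts are exactly the targets.\<close>
  have mean: "(\<Sum>g\<in>indices. \<Sum>\<mu>\<in>\<Omega> g. P g \<mu> * X g \<mu> \<rho>) = real num_blocks * (fact (v - card \<rho>) / fact v)"
    if \<rho>: "\<rho> \<in> small_matchings" for \<rho>
  proof -
    have fill: "(\<Sum>\<mu>\<in>\<Omega> ({}, True, m). P ({}, True, m) \<mu> * X ({}, True, m) \<mu> \<rho>)
        = (\<Sum>\<kappa> | \<kappa> \<in> \<M> \<and> \<rho> \<subseteq> \<kappa>. filler_prob \<kappa>)" for m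
    proof -
      have "(\<Sum>\<mu>\<in>\<Omega> ({}, True, m). P ({}, True, m) \<mu> * X ({}, True, m) \<mu> \<rho>)
          = (\<Sum>\<mu>\<in>\<M>. if \<rho> \<subseteq> \<mu> then filler_prob \<mu> else 0)"
      proof (rule sum.cong)
        fix \<mu>
        have "{\<kappa>. \<kappa> = \<mu> \<and> \<rho> \<subseteq> \<kappa>} = (if \<rho> \<subseteq> \<mu> then {\<mu>} else {})" by auto
        then show "P ({}, True, m) \<mu> * X ({}, True, m) \<mu> \<rho> = (if \<rho> \<subseteq> \<mu> then filler_prob \<mu> else 0)"
          by (simp add: P_def X_def piece_def half_empty)
      qed (simp add: \<Omega>_def)
      then show ?thesis using finM by (simp add: sum.inter_filter)
    qed
    have gad: "(\<Sum>g\<in>gadgets. \<Sum>\<mu>\<in>\<Omega> g. P g \<mu> * X g \<mu> \<rho>) = (\<Sum>\<kappa> | \<kappa> \<in> \<M> \<and> \<rho> \<subseteq> \<kappa>. excess \<kappa>)"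
      unfolding sum_excess
    proof (rule sum.cong[OF refl], clarify)
      fix \<sigma> \<epsilon> m assume "(\<sigma>, \<epsilon>, m) \<in> gadgets"
      from gadgetsD(3)[OF this] show "(\<Sum>\<mu>\<in>\<Omega> (\<sigma>, \<epsilon>, m). P (\<sigma>, \<epsilon>, m) \<mu> * X (\<sigma>, \<epsilon>, m) \<mu> \<rho>)
          = (\<Sum>\<mu> | \<mu> \<in> \<M> \<and> \<sigma> \<subseteq> \<mu>. gadget_prob \<sigma> \<mu> * real (card {\<kappa> \<in> half \<sigma> \<epsilon> \<mu>. \<rho> \<subseteq> \<kappa>}))"
        by (simp add: P_def X_def \<Omega>_def piece_def)
    qed
    have "(\<Sum>g\<in>indices. \<Sum>\<mu>\<in>\<Omega> g. P g \<mu> * X g \<mu> \<rho>)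
        = real fillers * (\<Sum>\<kappa> | \<kappa> \<in> \<M> \<and> \<rho> \<subseteq> \<kappa>. filler_prob \<kappa>) + (\<Sum>\<kappa> | \<kappa> \<in> \<M> \<and> \<rho> \<subseteq> \<kappa>. excess \<kappa>)"
      unfolding sum_indices fill gad by simp
    also have "\<dots> = real num_blocks * (\<Sum>\<kappa> | \<kappa> \<in> \<M> \<and> \<rho> \<subseteq> \<kappa>. wt \<kappa>)"
      using fillers_sum_filler_prob[of "\<lambda>\<kappa>. \<rho> \<subseteq> \<kappa>"] by linarith
    also have "\<dots> = real num_blocks * (fact (v - card \<rho>) / fact v)"
      using wt_superset[of \<rho>] \<rho> by (simp only: small_matchings_def mem_Collect_eq)
    finally show ?thesis .
  qed
  have "\<bar>(\<Sum>g\<in>indices. X g (sel g) \<rho>) - real num_blocks * (fact (v - card \<rho>) / fact v)\<bar> \<le> 16 * real q ^ 10"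
    if \<rho>: "\<rho> \<in> small_matchings" for \<rho>
  proof -
    let ?D = "\<lambda>\<rho>. \<Sum>g\<in>indices. X g (sel g) \<rho> - (\<Sum>\<mu>\<in>\<Omega> g. P g \<mu> * X g \<mu> \<rho>)"
    have "(?D \<rho>)\<^sup>2 \<le> (\<Sum>\<rho>\<in>small_matchings. (?D \<rho>)\<^sup>2)"
      by (rule member_le_sum[OF \<rho>]) (use finite_small_matchings in auto)
    also have "\<dots> \<le> 2 * real (card indices) * real q ^ 4" by (rule sel(3))
    also have "\<dots> \<le> 2 * real (2 * (64 * q ^ 16)) * real q ^ 4"
    proof -
      have "card indices \<le> 2 * (64 * q ^ 16)" using card_indices_le num_blocks_le by linarith
      then have "real (card indices) \<le> real (2 * (64 * q ^ 16))" by (simp only: of_nat_le_iff)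
      then show ?thesis by (intro mult_right_mono mult_left_mono) auto
    qed
    also have "\<dots> = (16 * real q ^ 10)\<^sup>2"
      by (simp add: power_mult_distrib power_mult[symmetric] power_add[symmetric])
    finally have "\<bar>?D \<rho>\<bar> \<le> \<bar>16 * real q ^ 10\<bar>" by (simp only: abs_le_square_iff)
    moreover have "?D \<rho> = (\<Sum>g\<in>indices. X g (sel g) \<rho>) - real num_blocks * (fact (v - card \<rho>) / fact v)"
      using mean[OF \<rho>] by (simp only: sum_subtractf)
    ultimately show ?thesis by simp
  qed
  then show ?thesis using sel(1,2) unfolding \<Omega>_def Bl_def X_def
    by (intro exI[of _ sel]) simp
qed

end

section \<open>From nearly uniform to uniform\<close>

context design_setting
begin

lemma small_matchings_closed: "\<rho> \<in> small_matchings \<Longrightarrow> \<sigma> \<subseteq> \<rho> \<Longrightarrow> \<sigma> \<in> small_matchings"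
proof -
  assume \<rho>: "\<rho> \<in> small_matchings" and \<sigma>: "\<sigma> \<subseteq> \<rho>"
  have "card \<sigma> \<le> card \<rho>" using \<rho> \<sigma> finite_of_M[of \<rho>] by (intro card_mono) (auto simp: small_matchings_def)
  then show "\<sigma> \<in> small_matchings" using \<rho> \<sigma> matching_subset[of \<rho> A B \<sigma>] by (auto simp: small_matchings_def)
qed

text \<open>
  The number of members that must contain \<open>\<rho>\<close>, in a form that is visibly a natural number.
\<close>
definition marginal :: "('a \<times> 'a) set \<Rightarrow> nat" where
  "marginal \<rho> = 4 * copies * q ^ 4 * (fact (v - card \<rho>) div fact (v - t))"

lemma marginal_eq:
  assumes "card \<rho> \<le> t"
  shows "real (marginal \<rho>) = real num_blocks * (fact (v - card \<rho>) / fact v)"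
proof -
  have "(fact (v - t) :: nat) dvd fact (v - card \<rho>)" using assms by (intro fact_dvd) auto
  then show ?thesis by (simp add: marginal_def num_blocks_eq real_of_nat_div)
qed

lemma copies_suffice: "16 * int (q ^ 10) * int (t + 1) ^ t \<le> int copies"
proof -
  have "(t + 1) ^ t \<le> q" unfolding q_def using t_less by (intro power_mono) auto
  then have "16 * q ^ 10 * (t + 1) ^ t \<le> 16 * q ^ 10 * q" by (rule mult_le_mono2)
  also have "16 * q ^ 10 * q = copies"
    using power_add[of q 10 1] by (simp add: copies_def)
  finally have "int (16 * q ^ 10 * (t + 1) ^ t) \<le> int copies" by (simp only: of_nat_le_iff)
  then show ?thesis by simp
qed

text \<open>
  The errors of the balanced family are integers; \<open>level_correction\<close> says which gadgets to switch.
  Each switched gadget replaces its present half by the opposite one.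
\<close>
lemma uniform_matchings_exist:
  "\<exists>T. T \<subseteq> \<M> \<and> inj_on (swap B) T \<and>
    (\<forall>\<rho>\<in>\<M>. card \<rho> \<le> t \<longrightarrow> real (card {\<mu> \<in> T. \<rho> \<subseteq> \<mu>}) = real num_blocks * (fact (v - card \<rho>) / fact v))"
proof -
  from balanced_default obtain sel where
    sel_all: "\<forall>g\<in>indices. sel g \<in> \<M> \<and> fst g \<subseteq> sel g"
    and dis_all: "\<forall>g\<in>indices. \<forall>h\<in>indices. g \<noteq> h \<longrightarrow>
          swap B ` cube (fst g) (sel g) \<inter> swap B ` cube (fst h) (sel h) = {}"
    and bal_all: "\<forall>\<rho>\<in>small_matchings. \<bar>(\<Sum>g\<in>indices. real (card {\<kappa> \<in> piece g (sel g). \<rho> \<subseteq> \<kappa>}))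
          - real num_blocks * (fact (v - card \<rho>) / fact v)\<bar> \<le> 16 * real q ^ 10"
    by (elim exE conjE)
  have sel: "sel g \<in> \<M>" "fst g \<subseteq> sel g" if "g \<in> indices" for g
    using sel_all that by auto
  note dis = dis_all[rule_format]
  note bal = bal_all[rule_format]
  define d where "d \<rho> = int (\<Sum>g\<in>indices. card {\<kappa> \<in> piece g (sel g). \<rho> \<subseteq> \<kappa>}) - int (marginal \<rho>)" for \<rho>
  have d_le: "\<bar>d \<rho>\<bar> \<le> 16 * int (q ^ 10)" if \<rho>: "\<rho> \<in> small_matchings" for \<rho>
  proof -
    have "real_of_int \<bar>d \<rho>\<bar> \<le> real_of_int (16 * int (q ^ 10))"
      using bal[OF \<rho>] marginal_eq[of \<rho>] \<rho> by (simp add: d_def small_matchings_def)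
    then show ?thesis by (simp only: of_int_le_iff)
  qed
  have filler_size: "card (piece ({}, True, m) \<mu>) = 1" for m \<mu>
    by (simp add: piece_def half_empty)
  have "(\<Sum>g\<in>indices. card (piece g (sel g))) = num_blocks"
  proof -
    have "(\<Sum>g\<in>gadgets. card (piece g (sel g))) = (\<Sum>(\<sigma>, \<epsilon>, m)\<in>gadgets. 2 ^ (card \<sigma> - 1))"
    proof (rule sum.cong[OF refl], clarify)
      fix \<sigma> \<epsilon> m assume g: "(\<sigma>, \<epsilon>, m) \<in> gadgets"
      then have "\<sigma> \<subseteq> sel (\<sigma>, \<epsilon>, m)" using sel(2)[of "(\<sigma>, \<epsilon>, m)"] by (simp add: indices_def)
      then show "card (piece (\<sigma>, \<epsilon>, m) (sel (\<sigma>, \<epsilon>, m))) = 2 ^ (card \<sigma> - 1)"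
        using gadgetsD[OF g] by (simp add: piece_def card_half)
    qed
    then have "(\<Sum>g\<in>indices. card (piece g (sel g))) = fillers + gadget_blocks"
      by (simp add: sum_indices filler_size gadget_blocks_def)
    moreover have "real (fillers + gadget_blocks) = real num_blocks" using fillers_eq by simp
    ultimately show ?thesis by (simp only: of_nat_eq_iff)
  qed
  moreover have "real (marginal {}) = real num_blocks" using marginal_eq[of "{}"] by simp
  ultimately have d0: "d {} = 0" by (simp add: d_def)
  have gi: "(\<sigma>, \<epsilon>, m) \<in> indices" if "\<sigma> \<in> small_matchings" "\<sigma> \<noteq> {}" "m < copies" for \<sigma> \<epsilon> m
    using that by (simp add: indices_def gadgets_def)
  have "\<exists>n. (\<forall>\<sigma>\<in>small_matchings. \<bar>n \<sigma>\<bar> \<le> int copies) \<and>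
    (\<forall>\<rho>\<in>small_matchings. d \<rho> + (\<Sum>\<sigma>\<in>Pow \<rho> - {{}}. sgn (n \<sigma>) *
        int (card {m. m < nat \<bar>n \<sigma>\<bar> \<and> \<rho> \<subseteq> sel (\<sigma>, n \<sigma> < 0, m)})) = 0)"
  proof (rule level_correction[where \<mu> = "\<lambda>\<sigma> \<epsilon> m. sel (\<sigma>, \<epsilon>, m)" and t = t and \<Delta> = "16 * int (q ^ 10)"])
    show "finite \<rho> \<and> card \<rho> \<le> t" if "\<rho> \<in> small_matchings" for \<rho> using that finite_of_M by (simp add: small_matchings_def)
    show "\<sigma> \<subseteq> sel (\<sigma>, \<epsilon>, m)" if "\<sigma> \<in> small_matchings" "\<sigma> \<noteq> {}" "m < copies" for \<sigma> \<epsilon> m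
      using sel(2)[OF gi[OF that]] by simp
  qed (use small_matchings_closed d0 d_le copies_suffice in blast)+
  then obtain n where n_le: "\<And>\<sigma>. \<sigma> \<in> small_matchings \<Longrightarrow> \<bar>n \<sigma>\<bar> \<le> int copies"
    and n: "\<And>\<rho>. \<rho> \<in> small_matchings \<Longrightarrow> d \<rho> + (\<Sum>\<sigma>\<in>Pow \<rho> - {{}}. sgn (n \<sigma>) *
        int (card {m. m < nat \<bar>n \<sigma>\<bar> \<and> \<rho> \<subseteq> sel (\<sigma>, n \<sigma> < 0, m)})) = 0" by blast
  \<comment> \<open>The gadgets for \<open>\<sigma>\<close> used are the first \<open>\<bar>n \<sigma>\<bar>\<close> ones of the matching sign.\<close>
  define switched where "switched g \<longleftrightarrow> (case g of (\<sigma>, \<epsilon>, m) \<Rightarrow> \<sigma> \<noteq> {} \<and> \<epsilon> = (n \<sigma> < 0) \<and> m < nat \<bar>n \<sigma>\<bar>)" for g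
  define K where "K g = half (fst g) (fst (snd g) \<noteq> switched g) (sel g)" for g
  define T where "T = (\<Union>g\<in>indices. K g)"
  have K_cube: "K g \<subseteq> cube (fst g) (sel g)" for g by (simp add: K_def half_subset_cube)
  have T_sub: "T \<subseteq> \<M>"
    using K_cube cube_subset_M[OF sel] unfolding T_def by blast
  have inj: "inj_on (swap B) T"
  proof (rule inj_onI)
    fix \<kappa> \<kappa>' assume "\<kappa> \<in> T" "\<kappa>' \<in> T" and eq: "swap B \<kappa> = swap B \<kappa>'"
    then obtain g h where gh: "g \<in> indices" "h \<in> indices"
      "\<kappa> \<in> cube (fst g) (sel g)" "\<kappa>' \<in> cube (fst h) (sel h)"
      using K_cube unfolding T_def by blast
    have "g = h"
    proof (rule ccontr)
      assume "g \<noteq> h"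
      from dis[OF gh(1,2) this] gh(3,4) eq show False by (metis disjoint_iff imageI)
    qed
    then show "\<kappa> = \<kappa>'"
      using inj_on_swap_cube[OF sel[OF gh(1)]] gh(3,4) eq by (auto dest: inj_onD)
  qed
  have K_disj: "K g \<inter> K h = {}" if "g \<in> indices" "h \<in> indices" "g \<noteq> h" for g h
    using dis[OF that] K_cube[of g] K_cube[of h] by blast
  have cnt: "real (card {\<mu> \<in> T. \<rho> \<subseteq> \<mu>}) = real num_blocks * (fact (v - card \<rho>) / fact v)"
    if \<rho>M: "\<rho> \<in> \<M>" "card \<rho> \<le> t" for \<rho>
  proof -
    have \<rho>: "\<rho> \<in> small_matchings" using \<rho>M by (simp add: small_matchings_def)
    \<comment> \<open>The effect at \<open>\<rho>\<close> of the \<open>m\<close>-th gadget for \<open>\<sigma>\<close> of the sign in use.\<close>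
    define change where "change \<sigma> = (\<lambda>m. if m < nat \<bar>n \<sigma>\<bar> \<and> \<sigma> \<subseteq> \<rho> \<and> \<rho> \<subseteq> sel (\<sigma>, n \<sigma> < 0, m) then sgn (n \<sigma>) else 0)" for \<sigma>
    have fin_half: "finite (half (fst g) \<epsilon> (sel g))" if "g \<in> indices" for g \<epsilon>
      using finite_half[OF indicesD(3)[OF that]] .
    have "{\<mu> \<in> T. \<rho> \<subseteq> \<mu>} = (\<Union>g\<in>indices. {\<mu> \<in> K g. \<rho> \<subseteq> \<mu>})" by (auto simp: T_def)
    also have "card \<dots> = (\<Sum>g\<in>indices. card {\<mu> \<in> K g. \<rho> \<subseteq> \<mu>})"
    proof (rule card_UN_disjoint[OF finite_indices])
      show "\<forall>i\<in>indices. finite {\<mu> \<in> K i. \<rho> \<subseteq> \<mu>}" using fin_half by (simp add: K_def)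
      show "\<forall>i\<in>indices. \<forall>j\<in>indices. i \<noteq> j \<longrightarrow> {\<mu> \<in> K i. \<rho> \<subseteq> \<mu>} \<inter> {\<mu> \<in> K j. \<rho> \<subseteq> \<mu>} = {}"
        using K_disj by blast
    qed
    finally have "int (card {\<mu> \<in> T. \<rho> \<subseteq> \<mu>}) = (\<Sum>g\<in>indices. int (card {\<mu> \<in> K g. \<rho> \<subseteq> \<mu>}))" by simp
    also have "\<dots> = (\<Sum>g\<in>indices. int (card {\<kappa> \<in> piece g (sel g). \<rho> \<subseteq> \<kappa>}) +
        (if switched g \<and> fst g \<subseteq> \<rho> \<and> \<rho> \<subseteq> sel g then sgn (n (fst g)) else 0))"
    proof (rule sum.cong[OF refl])
      fix g assume g: "g \<in> indices"
      obtain \<sigma> \<epsilon> m where ge: "g = (\<sigma>, \<epsilon>, m)" by (cases g)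
      have sw: "int (card {\<kappa> \<in> half \<sigma> True (sel g). \<rho> \<subseteq> \<kappa>}) - int (card {\<kappa> \<in> half \<sigma> False (sel g). \<rho> \<subseteq> \<kappa>})
          = (if \<sigma> \<subseteq> \<rho> \<and> \<rho> \<subseteq> sel g then 1 else 0)"
        using half_switch[OF indicesD(3)[OF g] sel(2)[OF g], of \<rho>] by (simp add: ge)
      show "int (card {\<mu> \<in> K g. \<rho> \<subseteq> \<mu>}) = int (card {\<kappa> \<in> piece g (sel g). \<rho> \<subseteq> \<kappa>}) +
        (if switched g \<and> fst g \<subseteq> \<rho> \<and> \<rho> \<subseteq> sel g then sgn (n (fst g)) else 0)"
      proof (cases "switched g")
        case False
        then show ?thesis by (simp add: K_def piece_def)
      next
        case True
        then have e: "\<epsilon> = (n \<sigma> < 0)" "n \<sigma> \<noteq> 0" by (auto simp: switched_def ge)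
        show ?thesis
        proof (cases "n \<sigma> < 0")
          case neg: True
          then have "K g = half \<sigma> False (sel g)" "piece g (sel g) = half \<sigma> True (sel g)"
            using True e by (auto simp: K_def piece_def ge)
          then show ?thesis using sw neg True by (auto simp: ge split: if_splits)
        next
          case pos: False
          then have "K g = half \<sigma> True (sel g)" "piece g (sel g) = half \<sigma> False (sel g)"
            using True e by (auto simp: K_def piece_def ge)
          then show ?thesis using sw pos e(2) True by (auto simp: ge sgn_if split: if_splits)
        qed
      qed
    qed
    also have "\<dots> = (d \<rho> + int (marginal \<rho>)) +
        (\<Sum>g\<in>indices. if switched g \<and> fst g \<subseteq> \<rho> \<and> \<rho> \<subseteq> sel g then sgn (n (fst g)) else 0)"
      by (simp add: sum.distrib d_def)
    also have "(\<Sum>g\<in>indices. if switched g \<and> fst g \<subseteq> \<rho> \<and> \<rho> \<subseteq> sel g then sgn (n (fst g)) else 0)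
        = (\<Sum>(\<sigma>, \<epsilon>, m)\<in>gadgets. if \<epsilon> = (n \<sigma> < 0) then change \<sigma> m else 0)"
    proof -
      have "(\<Sum>m<fillers. if switched ({}, True, m) \<and> fst ({}, True, m) \<subseteq> \<rho> \<and> \<rho> \<subseteq> sel ({}, True, m)
          then sgn (n (fst ({}, True, m))) else 0) = 0"
        by (rule sum.neutral) (simp add: switched_def)
      moreover have "(\<Sum>g\<in>gadgets. if switched g \<and> fst g \<subseteq> \<rho> \<and> \<rho> \<subseteq> sel g then sgn (n (fst g)) else 0)
          = (\<Sum>(\<sigma>, \<epsilon>, m)\<in>gadgets. if \<epsilon> = (n \<sigma> < 0) then change \<sigma> m else 0)"
        by (rule sum.cong[OF refl], clarify) (auto simp: switched_def change_def dest: gadgetsD(3))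
      ultimately show ?thesis by (simp add: sum_indices)
    qed
    also have "\<dots> = (\<Sum>\<sigma>\<in>small_matchings - {{}}. \<Sum>\<epsilon>\<in>UNIV. \<Sum>m<copies. if \<epsilon> = (n \<sigma> < 0) then change \<sigma> m else 0)"
      by (simp only: gadgets_def sum.cartesian_product)
    also have "\<dots> = (\<Sum>\<sigma>\<in>small_matchings - {{}}. \<Sum>m<copies. change \<sigma> m)"
    proof (rule sum.cong[OF refl])
      fix \<sigma>
      show "(\<Sum>\<epsilon>\<in>UNIV. \<Sum>m<copies. if \<epsilon> = (n \<sigma> < 0) then change \<sigma> m else 0) = (\<Sum>m<copies. change \<sigma> m)"
        by (cases "n \<sigma> < 0") (simp_all add: UNIV_bool)
    qed
    also have "\<dots> = (\<Sum>\<sigma>\<in>Pow \<rho> - {{}}. \<Sum>m<copies. change \<sigma> m)"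
    proof (rule sum.mono_neutral_right)
      show "finite (small_matchings - {{}})" using finite_small_matchings by simp
      show "Pow \<rho> - {{}} \<subseteq> small_matchings - {{}}" using small_matchings_closed[OF \<rho>] by auto
      show "\<forall>\<sigma>\<in>small_matchings - {{}} - (Pow \<rho> - {{}}). (\<Sum>m<copies. change \<sigma> m) = 0"
        by (intro ballI sum.neutral) (auto simp: change_def)
    qed
    also have "\<dots> = (\<Sum>\<sigma>\<in>Pow \<rho> - {{}}. sgn (n \<sigma>) *
        int (card {m. m < nat \<bar>n \<sigma>\<bar> \<and> \<rho> \<subseteq> sel (\<sigma>, n \<sigma> < 0, m)}))"
    proof (rule sum.cong[OF refl])
      fix \<sigma> assume \<sigma>: "\<sigma> \<in> Pow \<rho> - {{}}"
      then have le: "nat \<bar>n \<sigma>\<bar> \<le> copies" using n_le[of \<sigma>] small_matchings_closed[OF \<rho>, of \<sigma>] by auto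
      have "(\<Sum>m<copies. change \<sigma> m)
          = (\<Sum>m\<in>{m. m < nat \<bar>n \<sigma>\<bar> \<and> \<rho> \<subseteq> sel (\<sigma>, n \<sigma> < 0, m)}. sgn (n \<sigma>))"
        using le \<sigma> by (intro sum.mono_neutral_cong_right) (auto simp: change_def)
      then show "(\<Sum>m<copies. change \<sigma> m)
          = sgn (n \<sigma>) * int (card {m. m < nat \<bar>n \<sigma>\<bar> \<and> \<rho> \<subseteq> sel (\<sigma>, n \<sigma> < 0, m)})" by simp
    qed
    finally have "int (card {\<mu> \<in> T. \<rho> \<subseteq> \<mu>}) = int (marginal \<rho>)" using n[OF \<rho>] by linarith
    then show ?thesis using marginal_eq[OF \<rho>M(2)] by simp
  qed
  show ?thesis using T_sub inj cnt by blast
qed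

end

section \<open>Existence of small designs\<close>

lemma is_design_all_subsets:
  assumes "t \<le> k"
  shows "is_design t v k ((v - t) choose (k - t)) {s. s \<subseteq> {1..v} \<and> card s = k}"
  unfolding is_design_def using card_supersets_of_size[of "{1..v}" _ k] assms by auto

lemma small_design_exists:
  assumes t: "1 \<le> t" "t < v" "t \<le> k" "k \<le> v" and big: "(v ^ t) ^ 50 \<le> v choose k"
  shows "\<exists>l T. is_design t v k l T \<and> T \<noteq> {} \<and> card T \<le> (v ^ t) ^ 22"
proof -
  interpret design_setting "{k + 1..v}" "{1..k}" t
  proof unfold_locales
    have "card {k + 1..v} + card {1..k} = v" using t by simp
    then show "t < card {k + 1..v} + card {1..k}"
      "real (((card {k + 1..v} + card {1..k}) ^ t) ^ 50) \<le> real ((card {k + 1..v} + card {1..k}) choose card {1..k})"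
      using t big by (simp_all only: of_nat_le_iff card_atLeastAtMost) simp
  qed (use t in auto)
  have V: "{k + 1..v} \<union> {1..k} = {1..v}" using t by auto
  from uniform_matchings_exist obtain T where
    T: "T \<subseteq> matchings {k + 1..v} {1..k}" "inj_on (swap {1..k}) T"
    and cnt_all: "\<forall>\<rho>\<in>matchings {k + 1..v} {1..k}. card \<rho> \<le> t \<longrightarrow>
      real (card {\<mu> \<in> T. \<rho> \<subseteq> \<mu>})
        = real num_blocks * (fact (card {k + 1..v} + card {1..k} - card \<rho>) / fact (card {k + 1..v} + card {1..k}))"
    by (elim exE conjE)
  note cnt = cnt_all[rule_format]
  let ?D = "swap {1..k} ` T"
  have same: "card {s \<in> ?D. I \<subseteq> s} = card {s \<in> ?D. {1..t} \<subseteq> s}" if I: "I \<subseteq> {1..v}" "card I = t" for I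
  proof -
    note count = uniform_matchings_give_design[OF T cnt, where t = t]
    have "real (card {s \<in> ?D. I \<subseteq> s}) = real (card {s \<in> ?D. {1..t} \<subseteq> s})"
    proof (rule trans[OF count count[symmetric]])
      show "I \<subseteq> {k + 1..v} \<union> {1..k}" "{1..t} \<subseteq> {k + 1..v} \<union> {1..k}" using I t V by auto
    qed (use I t in auto)
    then show ?thesis by (simp only: of_nat_eq_iff)
  qed
  have "is_design t v k (card {s \<in> ?D. {1..t} \<subseteq> s}) ?D"
    unfolding is_design_def
  proof (intro conjI ballI allI impI)
    fix s assume "s \<in> ?D"
    then obtain \<mu> where "\<mu> \<in> matchings {k + 1..v} {1..k}" "s = swap {1..k} \<mu>" using T(1) by blast
    then show "s \<subseteq> {1..v}" "card s = k" using swap_subset[of \<mu>] card_swap[of \<mu>] V by auto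
  qed (use same in blast)
  moreover have cD: "card ?D = num_blocks"
  proof -
    have "real (card T) = real num_blocks" using cnt[of "{}"] by simp
    then show ?thesis using card_image[OF T(2)] by simp
  qed
  moreover have "num_blocks \<le> (v ^ t) ^ 22"
  proof -
    have "num_blocks \<le> 64 * q ^ 16" by (rule num_blocks_le)
    also have "\<dots> \<le> q ^ 6 * q ^ 16"
    proof (rule mult_le_mono1)
      have "(2::nat) ^ 6 \<le> q ^ 6" using q_ge2 by (intro power_mono) auto
      then show "64 \<le> q ^ 6" by simp
    qed
    also have "\<dots> = q ^ 22" by (simp add: power_add[symmetric])
    also have "q = v ^ t" unfolding q_def using t by simp
    finally show ?thesis .
  qed
  moreover have "?D \<noteq> {}"
  proof
    assume "?D = {}"
    then have "card ?D = 0" by (simp only: card.empty)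
    then show False using cD num_blocks_pos by linarith
  qed
  ultimately have "is_design t v k (card {s \<in> ?D. {1..t} \<subseteq> s}) ?D \<and> ?D \<noteq> {} \<and> card ?D \<le> (v ^ t) ^ 22"
    by (simp only: simp_thms)
  then show ?thesis by blast
qed

theorem theorem1p2:
  "\<exists>c::real. c > 0 \<and>
     (\<forall>v t k :: nat. 1 \<le> v \<and> 1 \<le> t \<and> t \<le> v \<and> t \<le> k \<and> k \<le> v \<longrightarrow>
        (\<exists>(l::nat) (T :: nat set set). is_design t v k l T \<and> T \<noteq> {} \<and>
           real (card T) \<le> real v powr (c * real t)))"
\<comment> \<open>The exponent comes from the collision estimate, which needs \<open>2 ^ 15 * q ^ 35 \<le> v choose k\<close> with \<open>q = v ^ t \<ge> 2\<close>.\<close>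
proof (rule exI[of _ 50], intro conjI allI impI)
  fix v t k :: nat
  assume h: "1 \<le> v \<and> 1 \<le> t \<and> t \<le> v \<and> t \<le> k \<and> k \<le> v"
  have "\<exists>(l::nat) (T :: nat set set). is_design t v k l T \<and> T \<noteq> {} \<and> card T \<le> (v ^ t) ^ 50"
  proof (cases "v choose k \<le> (v ^ t) ^ 50")
    case True
    have c: "card {s. s \<subseteq> {1..v} \<and> card s = k} = v choose k"
      using n_subsets[of "{1..v}" k] by simp
    have "v choose k > 0" using h by (simp add: zero_less_binomial)
    then have "{s. s \<subseteq> {1..v} \<and> card s = k} \<noteq> {}" using c by (metis card.empty less_irrefl)
    moreover have "card {s. s \<subseteq> {1..v} \<and> card s = k} \<le> (v ^ t) ^ 50"
      using c True by (simp only:)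
    ultimately show ?thesis using is_design_all_subsets[of t k v] h by blast
  next
    case False
    have "t < v"
    proof (rule ccontr)
      assume "\<not> t < v"
      then have "k = v" using h by simp
      then show False using False h by simp
    qed
    then obtain l T where "is_design t v k l T" "T \<noteq> {}" "card T \<le> (v ^ t) ^ 22"
      using small_design_exists[of t v k] h False by auto
    moreover have "(v ^ t) ^ 22 \<le> (v ^ t) ^ 50" using h by (intro power_increasing) auto
    ultimately show ?thesis by (meson le_trans)
  qed
  then obtain l T where T: "is_design t v k l T" "T \<noteq> {}" "card T \<le> (v ^ t) ^ 50" by blast
  have "real (card T) \<le> real ((v ^ t) ^ 50)" using T(3) by (simp only: of_nat_le_iff)
  also have "\<dots> = real v powr real (t * 50)"
  proof -
    have "real v > 0" using h by simp
    then show ?thesis by (simp only: powr_realpow of_nat_power power_mult)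
  qed
  also have "\<dots> = real v powr (50 * real t)" by (simp add: mult.commute)
  finally show "\<exists>(l::nat) (T :: nat set set). is_design t v k l T \<and> T \<noteq> {} \<and>
      real (card T) \<le> real v powr (50 * real t)" using T by blast
qed simp

end
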